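(* Let $G$ be a topological group and let $\{e\} = G_0 \leq G_1 \leq \dots \leq G_n = G$ be a chain of subgroups, each of which is an amenable topological group with respect to the relative topology inherited from $G$. For each $i \in \{1,\dots,n\}$ let $\nu_i \in \mathrm{M}(G_i)$ be a $G_i$-left-invariant mean, and consider the convolution product $\mu := \nu_n \cdots \nu_1 \in \mathrm{M}(G)$. Let $d$ be a bounded, continuous, right-invariant pseudo-metric on $G$. Then, for every $f \in \mathrm{Lip}_1(G,d)$ and every real $\epsilon > 0$, $$\hat{\mu}\bigl(\{ \xi \in \mathrm{S}(G) \mid |\xi(f) - \mu(f)| \geq \epsilon \}\bigr) \leq 2 \exp\left( - \frac{\epsilon^2}{2\, \ell(G_0,\dots,G_n;d)^2} \right).$$
   Context: For a topological group $G$ and $g\in G$ let $\lambda_g\colon G\to G$, $x\mapsto gx$. $\mathrm{RUCB}(G)$ is the unital real Banach algebra (supremum norm) of all bounded functions $f\colon G\to\mathbb{R}$ such that for every $\epsilon>0$ there is a neighborhood $U$ of $e$ with $\|f-f\circ\lambda_g\|_\infty\le\epsilon$ for all $g\in U$. $\mathrm{M}(G)$ is the set of means on $G$, i.e., positive unital linear functionals $\mathrm{RUCB}(G)\to\mathbb{R}$. $\mathrm{S}(G)\subseteq \mathrm{M}(G)$ (the Samuel compactification) is the set of all unital ring homomorphisms $\mathrm{RUCB}(G)\to\mathbb{R}$, a compact Hausdorff space in the weak-$*$ topology. For $\mu\in \mathrm{M}(G)$, $\hat\mu$ denotes the unique regular Borel probability measure on $\mathrm{S}(G)$ with $\int \xi(f)\,d\hat\mu(\xi)=\mu(f)$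 for all $f\in\mathrm{RUCB}(G)$. A mean $\mu\in\mathrm{M}(G)$ is $H$-left-invariant (for a subgroup $H\le G$) if $\mu(f\circ\lambda_h)=\mu(f)$ for all $f\in\mathrm{RUCB}(G)$, $h\in H$. $G$ is amenable if $\mathrm{M}(G)$ contains a $G$-left-invariant mean. For $\mu\in\mathrm{M}(G)$ and $f\in\mathrm{RUCB}(G)$ let $(\Phi_\mu f)(g):=\mu(f\circ\lambda_g)$ $(g \in G)$; then $\Phi_\mu f\in\mathrm{RUCB}(G)$. The convolution product of $\mu,\nu\in\mathrm{M}(G)$ is $\mu\nu:=\mu\circ\Phi_\nu\in\mathrm{M}(G)$ (an associative operation). For a subgroup $H\le G$ with the relative topology, $\mathrm{M}(H)$ is regarded as a subset of $\mathrm{M}(G)$ by identifying $\nu\in\mathrm{M}(H)$ with $f\mapsto\nu(f|_H)$. A pseudo-metric $d$ on $G$ is continuous if the topology it generates is contained in the topology of $G$, and right-invariant if $d(xg,yg)=d(x,y)$ for all $g,x,y\in G$. $\mathrm{Lip}_1(G,d)$ is the set of all $f\colon G\to\mathbb{R}$ with $|f(x)-f(y)|\le d(x,y)$ for all $x,y\in G$ (for bounded continuous right-invariant $d$ it is contained in $\mathrm{RUCB}(G)$). Finally, $$\ell(G_0,\dots,G_n;d):=\Bigl(\sum_{i=0}^{n-1}\bigl(\sup_{g\in G}\operatorname{diam}(G_{i+1}/G_i,d_i^g)\bigr)^2\Bigr)^{1/2},$$ where $d_i^g$ is the pseudo-metric on $G_{i+1}/G_i=\{xG_i\mid x\in G_{i+1}\}$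 given by $d_i^g(xG_i,yG_i):=\inf_{h\in G_i}d(gx,gyh)$. In the case $\ell(G_0,\dots,G_n;d)=0$ the right-hand side of the inequality is read as $0$. *)

theory Defs
  imports "HOL-Algebra.Left_Coset" "HOL-Probability.Probability"
begin

text \<open>
  A topological group is a HOL-Algebra group together with a topology on its carrier (no separation
  axiom is imposed). A subgroup \<open>H\<close> with the relative topology is the pair
  \<open>G\<lparr>carrier := H\<rparr>\<close>, \<open>subtopology T H\<close>.

  Functions and functionals are represented extensionally: real functions on the group are
  \<open>undefined\<close> outside the carrier, and functionals on \<open>RUCB\<close> are \<open>undefined\<close> outside \<open>RUCB\<close>.
  Hence equality of HOL functions is equality of the mathematical objects.
\<close>

locale topological_group = group G for G :: "('a, 'b) monoid_scheme" (structure) +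
  fixes T :: "'a topology"
  assumes topspace_eq: "topspace T = carrier G"
    and continuous_mult: "continuous_map (prod_topology T T) T (\<lambda>(x, y). x \<otimes> y)"
    and continuous_inv: "continuous_map T T (\<lambda>x. inv x)"

definition ltrans :: "('a, 'b) monoid_scheme \<Rightarrow> ('a \<Rightarrow> real) \<Rightarrow> 'a \<Rightarrow> 'a \<Rightarrow> real" where
  "ltrans G f g = (\<lambda>x\<in>carrier G. f (g \<otimes>\<^bsub>G\<^esub> x))"  \<comment> \<open>\<open>f \<circ> \<lambda>\<^sub>g\<close>\<close>

definition RUCB :: "('a, 'b) monoid_scheme \<Rightarrow> 'a topology \<Rightarrow> ('a \<Rightarrow> real) set" where
  "RUCB G T = {f \<in> extensional (carrier G). bounded (f ` carrier G) \<and>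
     (\<forall>\<epsilon>>0. \<exists>U. openin T U \<and> \<one>\<^bsub>G\<^esub> \<in> U \<and>
        (\<forall>g\<in>U. \<forall>x\<in>carrier G. \<bar>f x - ltrans G f g x\<bar> \<le> \<epsilon>))}"

definition means :: "('a, 'b) monoid_scheme \<Rightarrow> 'a topology \<Rightarrow> (('a \<Rightarrow> real) \<Rightarrow> real) set" where
  "means G T = {\<mu> \<in> extensional (RUCB G T).
     (\<forall>f\<in>RUCB G T. \<forall>g\<in>RUCB G T. \<mu> (\<lambda>x\<in>carrier G. f x + g x) = \<mu> f + \<mu> g) \<and>
     (\<forall>f\<in>RUCB G T. \<forall>c. \<mu> (\<lambda>x\<in>carrier G. c * f x) = c * \<mu> f) \<and>
     (\<forall>f\<in>RUCB G T. (\<forall>x\<in>carrier G. 0 \<le> f x) \<longrightarrow> 0 \<le> \<mu> f) \<and>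
     \<mu> (\<lambda>x\<in>carrier G. 1) = 1}"

definition samuel :: "('a, 'b) monoid_scheme \<Rightarrow> 'a topology \<Rightarrow> (('a \<Rightarrow> real) \<Rightarrow> real) set" where
  "samuel G T = {\<xi> \<in> extensional (RUCB G T).
     (\<forall>f\<in>RUCB G T. \<forall>g\<in>RUCB G T. \<xi> (\<lambda>x\<in>carrier G. f x + g x) = \<xi> f + \<xi> g) \<and>
     (\<forall>f\<in>RUCB G T. \<forall>g\<in>RUCB G T. \<xi> (\<lambda>x\<in>carrier G. f x * g x) = \<xi> f * \<xi> g) \<and>
     \<xi> (\<lambda>x\<in>carrier G. 1) = 1}"

text \<open>The weak-\<open>*\<close> topology is the topology of pointwise convergence on \<open>RUCB\<close>.\<close>

definition samuel_topology ::
    "('a, 'b) monoid_scheme \<Rightarrow> 'a topology \<Rightarrow> (('a \<Rightarrow> real) \<Rightarrow> real) topology" where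
  "samuel_topology G T =
     subtopology (product_topology (\<lambda>_. euclideanreal) (RUCB G T)) (samuel G T)"

definition regular_borel_prob :: "'c topology \<Rightarrow> 'c measure \<Rightarrow> bool" where
  "regular_borel_prob X M \<longleftrightarrow>
     prob_space M \<and> sets M = sets (sigma (topspace X) {U. openin X U}) \<and>
     (\<forall>A\<in>sets M. emeasure M A = (INF U\<in>{U. openin X U \<and> A \<subseteq> U}. emeasure M U) \<and>
                  emeasure M A = (SUP K\<in>{K. compactin X K \<and> K \<subseteq> A}. emeasure M K))"

text \<open>
  \<open>is_hat G T \<mu> M\<close> says that \<open>M\<close> is the measure \<open>\<mu>\<close>-hat on the Samuel compactification; for
  \<open>\<mu> \<in> means G T\<close> exactly one such \<open>M\<close> exists by the Riesz representation theorem.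
\<close>

definition is_hat :: "('a, 'b) monoid_scheme \<Rightarrow> 'a topology \<Rightarrow>
    (('a \<Rightarrow> real) \<Rightarrow> real) \<Rightarrow> (('a \<Rightarrow> real) \<Rightarrow> real) measure \<Rightarrow> bool" where
  "is_hat G T \<mu> M \<longleftrightarrow> regular_borel_prob (samuel_topology G T) M \<and>
     (\<forall>f\<in>RUCB G T. (\<integral>\<xi>. \<xi> f \<partial>M) = \<mu> f)"

definition left_invariant_mean :: "('a, 'b) monoid_scheme \<Rightarrow> 'a topology \<Rightarrow> 'a set \<Rightarrow>
    (('a \<Rightarrow> real) \<Rightarrow> real) \<Rightarrow> bool" where
  "left_invariant_mean G T H \<mu> \<longleftrightarrow>
     \<mu> \<in> means G T \<and> (\<forall>f\<in>RUCB G T. \<forall>h\<in>H. \<mu> (ltrans G f h) = \<mu> f)"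

definition amenable :: "('a, 'b) monoid_scheme \<Rightarrow> 'a topology \<Rightarrow> bool" where
  "amenable G T \<longleftrightarrow> (\<exists>\<mu>. left_invariant_mean G T (carrier G) \<mu>)"

definition Phi :: "('a, 'b) monoid_scheme \<Rightarrow> (('a \<Rightarrow> real) \<Rightarrow> real) \<Rightarrow> ('a \<Rightarrow> real) \<Rightarrow> 'a \<Rightarrow> real"
  where "Phi G \<mu> f = (\<lambda>g\<in>carrier G. \<mu> (ltrans G f g))"

definition conv :: "('a, 'b) monoid_scheme \<Rightarrow> 'a topology \<Rightarrow>
    (('a \<Rightarrow> real) \<Rightarrow> real) \<Rightarrow> (('a \<Rightarrow> real) \<Rightarrow> real) \<Rightarrow> (('a \<Rightarrow> real) \<Rightarrow> real)" where
  "conv G T \<mu> \<nu> = (\<lambda>f\<in>RUCB G T. \<mu> (Phi G \<nu> f))"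

definition mean_embed :: "('a, 'b) monoid_scheme \<Rightarrow> 'a topology \<Rightarrow> 'a set \<Rightarrow>
    (('a \<Rightarrow> real) \<Rightarrow> real) \<Rightarrow> (('a \<Rightarrow> real) \<Rightarrow> real)" where
  "mean_embed G T H \<nu> = (\<lambda>f\<in>RUCB G T. \<nu> (restrict f H))"

text \<open>
  \<open>conv_prod G T \<nu> n\<close> is \<open>\<nu> n \<cdots> \<nu> 1\<close>. The empty product is the neutral element of the
  convolution, i.e. evaluation at the neutral element of the group.
\<close>

primrec conv_prod :: "('a, 'b) monoid_scheme \<Rightarrow> 'a topology \<Rightarrow>
    (nat \<Rightarrow> ('a \<Rightarrow> real) \<Rightarrow> real) \<Rightarrow> nat \<Rightarrow> (('a \<Rightarrow> real) \<Rightarrow> real)" where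
  "conv_prod G T \<nu> 0 = (\<lambda>f\<in>RUCB G T. f \<one>\<^bsub>G\<^esub>)"
| "conv_prod G T \<nu> (Suc n) = conv G T (\<nu> (Suc n)) (conv_prod G T \<nu> n)"

definition pseudo_metric_on :: "'a set \<Rightarrow> ('a \<Rightarrow> 'a \<Rightarrow> real) \<Rightarrow> bool" where
  "pseudo_metric_on S d \<longleftrightarrow> (\<forall>x\<in>S. \<forall>y\<in>S. 0 \<le> d x y \<and> d x y = d y x) \<and> (\<forall>x\<in>S. d x x = 0) \<and>
     (\<forall>x\<in>S. \<forall>y\<in>S. \<forall>z\<in>S. d x z \<le> d x y + d y z)"

definition pseudo_metric_topology :: "'a set \<Rightarrow> ('a \<Rightarrow> 'a \<Rightarrow> real) \<Rightarrow> 'a topology" where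
  "pseudo_metric_topology S d =
     topology_generated_by {{y \<in> S. d x y < r} | x r. x \<in> S \<and> 0 < r}"

definition bounded_pseudo_metric :: "'a set \<Rightarrow> ('a \<Rightarrow> 'a \<Rightarrow> real) \<Rightarrow> bool" where
  "bounded_pseudo_metric S d \<longleftrightarrow> (\<exists>B. \<forall>x\<in>S. \<forall>y\<in>S. d x y \<le> B)"

definition continuous_pseudo_metric :: "'a topology \<Rightarrow> ('a \<Rightarrow> 'a \<Rightarrow> real) \<Rightarrow> bool" where
  "continuous_pseudo_metric T d \<longleftrightarrow>
     (\<forall>U. openin (pseudo_metric_topology (topspace T) d) U \<longrightarrow> openin T U)"

definition right_invariant :: "('a, 'b) monoid_scheme \<Rightarrow> ('a \<Rightarrow> 'a \<Rightarrow> real) \<Rightarrow> bool" where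
  "right_invariant G d \<longleftrightarrow> (\<forall>g\<in>carrier G. \<forall>x\<in>carrier G. \<forall>y\<in>carrier G.
     d (x \<otimes>\<^bsub>G\<^esub> g) (y \<otimes>\<^bsub>G\<^esub> g) = d x y)"

definition Lip1 :: "('a, 'b) monoid_scheme \<Rightarrow> ('a \<Rightarrow> 'a \<Rightarrow> real) \<Rightarrow> ('a \<Rightarrow> real) set" where
  "Lip1 G d = {f \<in> extensional (carrier G).
     \<forall>x\<in>carrier G. \<forall>y\<in>carrier G. \<bar>f x - f y\<bar> \<le> d x y}"

text \<open>
  The pseudo-metric \<open>d\<^sub>i\<^sup>g\<close> on left cosets of \<open>H\<close> is defined by
  \<open>(xH, yH) \<mapsto> inf {d (gx) (gyh) | h \<in> H}\<close>. To have a function of the cosets, not of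
  representatives, the infimum is taken over both cosets; by right-invariance of \<open>d\<close> this is
  the formula above (lemma \<open>coset_pdist_l_coset\<close>).
\<close>

definition coset_pdist :: "('a, 'b) monoid_scheme \<Rightarrow> ('a \<Rightarrow> 'a \<Rightarrow> real) \<Rightarrow> 'a \<Rightarrow>
    'a set \<Rightarrow> 'a set \<Rightarrow> real" where
  "coset_pdist G d g A B = (INF (x, y)\<in>A \<times> B. d (g \<otimes>\<^bsub>G\<^esub> x) (g \<otimes>\<^bsub>G\<^esub> y))"

lemma coset_pdist_l_coset:
  assumes "group G" "subgroup H G" "right_invariant G d"
    and "g \<in> carrier G" "x \<in> carrier G" "y \<in> carrier G"
  shows "coset_pdist G d g (x <#\<^bsub>G\<^esub> H) (y <#\<^bsub>G\<^esub> H)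
       = (INF h\<in>H. d (g \<otimes>\<^bsub>G\<^esub> x) (g \<otimes>\<^bsub>G\<^esub> (y \<otimes>\<^bsub>G\<^esub> h)))"
proof -
  interpret group G by fact
  interpret H: subgroup H G by fact
  have eq: "d (g \<otimes>\<^bsub>G\<^esub> (x \<otimes>\<^bsub>G\<^esub> k)) (g \<otimes>\<^bsub>G\<^esub> (y \<otimes>\<^bsub>G\<^esub> h))
      = d (g \<otimes>\<^bsub>G\<^esub> x) (g \<otimes>\<^bsub>G\<^esub> (y \<otimes>\<^bsub>G\<^esub> (h \<otimes>\<^bsub>G\<^esub> inv\<^bsub>G\<^esub> k)))" if "k \<in> H" "h \<in> H" for k h
  proof -
    have c: "k \<in> carrier G" "h \<in> carrier G" using that H.subset by auto
    have "d (g \<otimes>\<^bsub>G\<^esub> x) (g \<otimes>\<^bsub>G\<^esub> (y \<otimes>\<^bsub>G\<^esub> (h \<otimes>\<^bsub>G\<^esub> inv\<^bsub>G\<^esub> k)))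
        = d ((g \<otimes>\<^bsub>G\<^esub> x) \<otimes>\<^bsub>G\<^esub> k) ((g \<otimes>\<^bsub>G\<^esub> (y \<otimes>\<^bsub>G\<^esub> (h \<otimes>\<^bsub>G\<^esub> inv\<^bsub>G\<^esub> k))) \<otimes>\<^bsub>G\<^esub> k)"
      using assms c by (simp add: right_invariant_def)
    also have "\<dots> = d (g \<otimes>\<^bsub>G\<^esub> (x \<otimes>\<^bsub>G\<^esub> k)) (g \<otimes>\<^bsub>G\<^esub> (y \<otimes>\<^bsub>G\<^esub> h))"
      using assms c by (simp add: m_assoc)
    finally show ?thesis by simp
  qed
  have "(\<lambda>(u, v). d (g \<otimes>\<^bsub>G\<^esub> u) (g \<otimes>\<^bsub>G\<^esub> v)) ` ((x <#\<^bsub>G\<^esub> H) \<times> (y <#\<^bsub>G\<^esub> H))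
      = (\<lambda>h. d (g \<otimes>\<^bsub>G\<^esub> x) (g \<otimes>\<^bsub>G\<^esub> (y \<otimes>\<^bsub>G\<^esub> h))) ` H" (is "?L = ?R")
  proof
    show "?L \<subseteq> ?R" by (auto simp: l_coset_def eq)
    have "d (g \<otimes>\<^bsub>G\<^esub> x) (g \<otimes>\<^bsub>G\<^esub> (y \<otimes>\<^bsub>G\<^esub> h)) \<in> ?L" if "h \<in> H" for h
    proof -
      have "x \<in> x <#\<^bsub>G\<^esub> H" using assms lcos_self by blast
      moreover have "y \<otimes>\<^bsub>G\<^esub> h \<in> y <#\<^bsub>G\<^esub> H" using that by (auto simp: l_coset_def)
      ultimately show ?thesis by (intro image_eqI[where x = "(x, y \<otimes>\<^bsub>G\<^esub> h)"]) auto
    qed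
    then show "?R \<subseteq> ?L" by auto
  qed
  then show ?thesis unfolding coset_pdist_def by (rule arg_cong)
qed

definition pdiam :: "'c set \<Rightarrow> ('c \<Rightarrow> 'c \<Rightarrow> real) \<Rightarrow> real" where
  "pdiam S \<rho> = (SUP (a, b)\<in>S \<times> S. \<rho> a b)"

definition chain_length :: "('a, 'b) monoid_scheme \<Rightarrow> (nat \<Rightarrow> 'a set) \<Rightarrow> nat \<Rightarrow>
    ('a \<Rightarrow> 'a \<Rightarrow> real) \<Rightarrow> real" where
  "chain_length G K n d = sqrt (\<Sum>i<n.
     (SUP g\<in>carrier G. pdiam (lcosets\<^bsub>G\<lparr>carrier := K (Suc i)\<rparr>\<^esub> (K i)) (coset_pdist G d g))\<^sup>2)"

end

theory Submission
  imports Defs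
begin

text \<open>
  Put \<open>f\<^sub>i(g) = (\<nu>\<^sub>i \<cdots> \<nu>\<^sub>1)(f \<circ> \<lambda>\<^sub>g)\<close>, an analogue of a martingale: \<open>f\<^sub>0 = f\<close>, the value of
  \<open>f\<^sub>n\<close> at the neutral element is \<open>\<mu>(f)\<close>, and \<open>f\<^sub>i\<^sub>+\<^sub>1(g)\<close> is the \<open>\<nu>\<^sub>i\<^sub>+\<^sub>1\<close>-average of
  \<open>f\<^sub>i \<circ> \<lambda>\<^sub>g\<close> over \<open>G\<^sub>i\<^sub>+\<^sub>1\<close>. Invariance of \<open>\<nu>\<^sub>i\<close> makes \<open>f\<^sub>i\<close> constant on left cosets of
  \<open>G\<^sub>i\<close>, and right-invariance of \<open>d\<close> keeps it 1-Lipschitz, so \<open>f\<^sub>i \<circ> \<lambda>\<^sub>g\<close> oscillates on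
  \<open>G\<^sub>i\<^sub>+\<^sub>1\<close> by at most the \<open>i\<close>-th diameter \<open>c\<^sub>i\<close>. Convexity of \<open>exp\<close> then costs a factor
  \<open>exp (t\<^sup>2 c\<^sub>i\<^sup>2 / 2)\<close> per step, which yields \<open>\<mu>(exp (t f)) \<le> exp (t \<mu>(f) + t\<^sup>2 \<ell>\<^sup>2 / 2)\<close>. The tail
  bound is Chernoff's, transferred to the Samuel compactification by
  \<open>exp (t \<xi>(f)) \<le> \<xi>(exp (t f))\<close>.
\<close>

section \<open>Rigidity of additive functions and exponential inequalities on the reals\<close>

text \<open>Elements of \<open>samuel\<close> are not assumed to be real-linear; this is what makes
  them fix constants. Additivity makes \<open>\<rho>\<close> fix the integers and commute with
  natural multiples, and nonnegativity makes it monotone, so a large multiple of any discrepancy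
  contradicts comparison with an integer.\<close>

lemma additive_nonneg_imp_id:
  fixes \<rho> :: "real \<Rightarrow> real"
  assumes add: "\<And>x y. \<rho> (x + y) = \<rho> x + \<rho> y"
    and nonneg: "\<And>x. 0 \<le> x \<Longrightarrow> 0 \<le> \<rho> x" and one: "\<rho> 1 = 1"
  shows "\<rho> x = x"
proof -
  have zero: "\<rho> 0 = 0" using add[of 0 0] by simp
  have neg: "\<rho> (- y) = - \<rho> y" for y using add[of y "- y"] zero by simp
  have scale: "\<rho> (real n * y) = real n * \<rho> y" for n y
    by (induction n) (simp_all add: zero add algebra_simps)
  have int: "\<rho> (of_int m) = of_int m" for m
    using scale[of _ 1] neg one by (cases m rule: int_cases2) simp_all
  have le: "y \<le> \<rho> y" for y
  proof (rule ccontr)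
    assume "\<not> y \<le> \<rho> y"
    \<comment> \<open>Once the gap is magnified beyond 1, the floor \<open>m\<close> of
      \<open>real n * y\<close> exceeds \<open>real n * \<rho> y\<close>, whereas monotonicity gives
      the opposite inequality.\<close>
    then obtain n where n: "1 < real n * (y - \<rho> y)"
      using reals_Archimedean3[of "y - \<rho> y"] by auto
    define m where "m = \<lfloor>real n * y\<rfloor>"
    have m: "of_int m \<le> real n * y" "real n * y < of_int m + 1" unfolding m_def by linarith+
    have "real n * \<rho> y = \<rho> (of_int m + (real n * y - of_int m))" by (simp add: scale)
    also have "\<dots> = of_int m + \<rho> (real n * y - of_int m)" by (simp only: add int)
    finally have "of_int m \<le> real n * \<rho> y" using nonneg[of "real n * y - of_int m"] m by simp
    with n m show False by (simp add: algebra_simps)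
  qed
  show ?thesis using le[of x] le[of "- x"] neg[of x] by simp
qed

text \<open>For \<open>0 \<le> c\<close> this is the auxiliary inequality of Hoeffding's lemma in
  exponential form, taken at weight \<open>1/2\<close> and interval length \<open>2 * c\<close>.
  Negative \<open>c\<close> follows because both sides are even.\<close>

lemma cosh_le_exp_sq: "cosh c \<le> exp (c\<^sup>2 / 2)" for c :: real
proof -
  have *: "cosh c \<le> exp (c\<^sup>2 / 2)" if "0 \<le> c" for c :: real
  proof -
    have "- (2 * c) * (1/2) + ln (1 + 1/2 * (exp (2 * c) - 1)) \<le> (2 * c)\<^sup>2 / 8"
      by (rule Hoeffdings_lemma_aux) (use that in auto)
    then have "exp (- c + ln ((1 + exp (2 * c)) / 2)) \<le> exp (c\<^sup>2 / 2)"
      by (simp add: field_simps power2_eq_square)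
    moreover have "exp (- c + ln ((1 + exp (2 * c)) / 2)) = cosh c"
    proof -
      have "1 + exp (2 * c) > 0" by (simp add: add_pos_pos)
      then have "exp (- c + ln ((1 + exp (2 * c)) / 2)) = exp (- c) * ((1 + exp (2 * c)) / 2)"
        by (subst exp_add) simp
      also have "\<dots> = cosh c"
        by (simp add: cosh_field_def field_simps flip: exp_add)
      finally show ?thesis .
    qed
    ultimately show ?thesis by metis
  qed
  show ?thesis using *[of c] *[of "- c"] by (cases "0 \<le> c") auto
qed

text \<open>The chord of \<open>exp\<close> over \<open>[-c, c]\<close>; for \<open>c = 0\<close> the junk slope \<open>0\<close> is harmless.\<close>

lemma exp_le_chord:
  fixes c x :: real
  assumes "\<bar>x\<bar> \<le> c"
  shows "exp x \<le> cosh c + sinh c / c * x"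
proof (cases "c = 0")
  case False
  then have c: "c > 0" using assms by linarith
  define w where "w = (c - x) / (2 * c)"
  have w: "0 \<le> w" "w \<le> 1" using assms c by (auto simp: w_def field_simps)
  have "exp ((1 - w) *\<^sub>R c + w *\<^sub>R (- c)) \<le> (1 - w) * exp c + w * exp (- c)"
    by (rule convex_onD[OF exp_convex]) (use w in auto)
  moreover have "(1 - w) *\<^sub>R c + w *\<^sub>R (- c) = x" using c by (simp add: w_def field_simps)
  moreover have "(1 - w) * exp c + w * exp (- c) = cosh c + sinh c / c * x"
    using c by (simp add: w_def cosh_field_def sinh_field_def field_simps)
  ultimately show ?thesis by simp
qed (use assms in auto)

text \<open>Expresses that a mean on \<open>G\<close> lives on \<open>H\<close> while it stays a
  functional on all of \<open>RUCB G T\<close>. Inequalities between functions then need to be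
  checked on \<open>H\<close> only, which is how a mean embedded from a subgroup behaves.\<close>

definition supported_mean :: "('a, 'b) monoid_scheme \<Rightarrow> 'a topology \<Rightarrow> 'a set \<Rightarrow>
    (('a \<Rightarrow> real) \<Rightarrow> real) \<Rightarrow> bool" where
  "supported_mean G T H N \<longleftrightarrow>
     N \<in> means G T \<and> (\<forall>f\<in>RUCB G T. (\<forall>x\<in>H. 0 \<le> f x) \<longrightarrow> 0 \<le> N f)"

lemma supported_mean_carrier: "N \<in> means G T \<Longrightarrow> supported_mean G T (carrier G) N"
  by (simp add: supported_mean_def means_def)

section \<open>Closure properties of the algebra \<open>RUCB\<close>\<close>

context topological_group
begin

lemma openin_carrier: "openin T U \<Longrightarrow> U \<subseteq> carrier G"
  using openin_subset topspace_eq by metis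

lemma RUCB_iff: "f \<in> RUCB G T \<longleftrightarrow> f \<in> extensional (carrier G) \<and>
   (\<exists>B. \<forall>x\<in>carrier G. \<bar>f x\<bar> \<le> B) \<and>
   (\<forall>\<epsilon>>0. \<exists>U. openin T U \<and> \<one> \<in> U \<and> (\<forall>g\<in>U. \<forall>x\<in>carrier G. \<bar>f x - f (g \<otimes> x)\<bar> \<le> \<epsilon>))"
  by (simp add: RUCB_def ltrans_def bounded_iff)

lemma RUCB_nbhd:
  assumes "f \<in> RUCB G T" "\<epsilon> > 0"
  obtains U where "openin T U" "\<one> \<in> U"
    "\<And>g x. g \<in> U \<Longrightarrow> x \<in> carrier G \<Longrightarrow> \<bar>f x - f (g \<otimes> x)\<bar> \<le> \<epsilon>"
proof -
  have "\<exists>U. openin T U \<and> \<one> \<in> U \<and> (\<forall>g\<in>U. \<forall>x\<in>carrier G. \<bar>f x - f (g \<otimes> x)\<bar> \<le> \<epsilon>)"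
    using assms unfolding RUCB_iff by blast
  then show thesis using that by blast
qed

text \<open>The values of \<open>f\<close> lie in a compact interval, on which \<open>\<phi>\<close>
  is bounded and uniformly continuous. Constants, affine maps, \<open>exp\<close> and
  \<open>sqrt\<close> are the instances used later.\<close>

lemma RUCB_compose:
  assumes f: "f \<in> RUCB G T" and \<phi>: "continuous_on UNIV (\<phi> :: real \<Rightarrow> real)"
  shows "(\<lambda>x\<in>carrier G. \<phi> (f x)) \<in> RUCB G T"
proof -
  obtain B where B: "\<forall>x\<in>carrier G. \<bar>f x\<bar> \<le> B" using f by (auto simp: RUCB_iff)
  have B': "f x \<in> {-B..B}" if "x \<in> carrier G" for x
    using bspec[OF B that] by (simp add: abs_le_iff)
  have cont: "continuous_on {-B..B} \<phi>" using \<phi> continuous_on_subset by blast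
  have "bounded (\<phi> ` {-B..B})"
    by (intro compact_imp_bounded compact_continuous_image cont) simp
  then obtain C where C: "\<forall>y\<in>{-B..B}. \<bar>\<phi> y\<bar> \<le> C" by (auto simp: bounded_iff)
  have uc: "uniformly_continuous_on {-B..B} \<phi>"
    by (intro compact_uniformly_continuous cont) simp
  have "\<exists>U. openin T U \<and> \<one> \<in> U \<and>
      (\<forall>g\<in>U. \<forall>x\<in>carrier G. \<bar>\<phi> (f x) - (\<lambda>x\<in>carrier G. \<phi> (f x)) (g \<otimes> x)\<bar> \<le> \<epsilon>)"
    if "\<epsilon> > 0" for \<epsilon>
  proof -
    obtain \<delta> where \<delta>: "\<delta> > 0" "\<And>x y. x \<in> {-B..B} \<Longrightarrow> y \<in> {-B..B} \<Longrightarrow> dist y x < \<delta> \<Longrightarrow> dist (\<phi> y) (\<phi> x) < \<epsilon>"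
      by (rule uniformly_continuous_onE[OF uc \<open>\<epsilon> > 0\<close>]) (rule that)
    obtain U where U: "openin T U" "\<one> \<in> U"
        "\<And>g x. g \<in> U \<Longrightarrow> x \<in> carrier G \<Longrightarrow> \<bar>f x - f (g \<otimes> x)\<bar> \<le> \<delta> / 2"
      using RUCB_nbhd[OF f half_gt_zero[OF \<delta>(1)]] by blast
    have "\<bar>\<phi> (f x) - (\<lambda>x\<in>carrier G. \<phi> (f x)) (g \<otimes> x)\<bar> \<le> \<epsilon>" if g: "g \<in> U" and x: "x \<in> carrier G" for g x
    proof -
      have "g \<in> carrier G" using g U(1) openin_carrier by blast
      then show ?thesis using \<delta>(2)[of "f (g \<otimes> x)" "f x"] B' U(3)[OF g x] x \<delta>(1) by (simp add: dist_real_def)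
    qed
    then show ?thesis using U by blast
  qed
  then show ?thesis using C B' unfolding RUCB_iff by (auto intro!: exI[of _ C])
qed

lemma RUCB_const: "(\<lambda>x\<in>carrier G. c) \<in> RUCB G T"
proof -
  have "(\<lambda>x\<in>carrier G. 0 :: real) \<in> RUCB G T"
    unfolding RUCB_iff using openin_topspace[of T] topspace_eq by (auto intro!: exI[of _ "carrier G"] exI[of _ 0])
  from RUCB_compose[OF this, of "\<lambda>_. c"] show ?thesis by simp
qed

lemma RUCB_affine: "f \<in> RUCB G T \<Longrightarrow> (\<lambda>x\<in>carrier G. a * f x + b) \<in> RUCB G T"
  by (erule RUCB_compose) (intro continuous_intros)

lemma RUCB_scale: "f \<in> RUCB G T \<Longrightarrow> (\<lambda>x\<in>carrier G. a * f x) \<in> RUCB G T"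
  by (erule RUCB_compose) (intro continuous_intros)

lemma RUCB_exp: "f \<in> RUCB G T \<Longrightarrow> (\<lambda>x\<in>carrier G. exp (t * f x)) \<in> RUCB G T"
  by (erule RUCB_compose) (intro continuous_intros)

lemma RUCB_add:
  assumes f: "f \<in> RUCB G T" and g: "g \<in> RUCB G T"
  shows "(\<lambda>x\<in>carrier G. f x + g x) \<in> RUCB G T"
proof -
  obtain B C where "\<forall>x\<in>carrier G. \<bar>f x\<bar> \<le> B" "\<forall>x\<in>carrier G. \<bar>g x\<bar> \<le> C"
    using f g by (auto simp: RUCB_iff)
  then have bd: "\<forall>x\<in>carrier G. \<bar>f x + g x\<bar> \<le> B + C" by (meson abs_triangle_ineq add_mono order_trans)
  have "\<exists>U. openin T U \<and> \<one> \<in> U \<and>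
      (\<forall>h\<in>U. \<forall>x\<in>carrier G. \<bar>f x + g x - (\<lambda>x\<in>carrier G. f x + g x) (h \<otimes> x)\<bar> \<le> \<epsilon>)"
    if "\<epsilon> > 0" for \<epsilon>
  proof -
    obtain U where U: "openin T U" "\<one> \<in> U"
        "\<And>h x. h \<in> U \<Longrightarrow> x \<in> carrier G \<Longrightarrow> \<bar>f x - f (h \<otimes> x)\<bar> \<le> \<epsilon> / 2"
      using RUCB_nbhd[OF f half_gt_zero[OF \<open>\<epsilon> > 0\<close>]] by blast
    obtain V where V: "openin T V" "\<one> \<in> V"
        "\<And>h x. h \<in> V \<Longrightarrow> x \<in> carrier G \<Longrightarrow> \<bar>g x - g (h \<otimes> x)\<bar> \<le> \<epsilon> / 2"
      using RUCB_nbhd[OF g half_gt_zero[OF \<open>\<epsilon> > 0\<close>]] by blast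
    have "\<bar>f x + g x - (\<lambda>x\<in>carrier G. f x + g x) (h \<otimes> x)\<bar> \<le> \<epsilon>"
      if h: "h \<in> U \<inter> V" and x: "x \<in> carrier G" for h x
    proof -
      have "h \<in> carrier G" using h U(1) openin_carrier by blast
      moreover have "\<bar>f x - f (h \<otimes> x)\<bar> \<le> \<epsilon> / 2" "\<bar>g x - g (h \<otimes> x)\<bar> \<le> \<epsilon> / 2"
        using U(3) V(3) h x by auto
      then have "\<bar>f x + g x - (f (h \<otimes> x) + g (h \<otimes> x))\<bar> \<le> \<epsilon>" by linarith
      ultimately show ?thesis using x by simp
    qed
    then show ?thesis using U V by (intro exI[of _ "U \<inter> V"]) auto
  qed
  then show ?thesis using bd unfolding RUCB_iff by (auto intro!: exI[of _ "B + C"])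
qed

text \<open>Left translation by \<open>g\<close> turns a perturbation by \<open>u\<close> into one
  by its conjugate, so neighbourhoods of the identity have to be pulled back along conjugation to
  handle \<open>ltrans\<close>.\<close>

lemma openin_conjugate:
  assumes "g \<in> carrier G" "openin T U"
  shows "openin T {u \<in> carrier G. g \<otimes> u \<otimes> inv g \<in> U}"
proof -
  have c: "continuous_map T T (\<lambda>_. a)" if "a \<in> carrier G" for a
    using that by (simp add: topspace_eq)
  have m: "continuous_map T T (\<lambda>u. p u \<otimes> q u)" if "continuous_map T T p" "continuous_map T T q" for p q
    using continuous_map_compose[OF continuous_map_pairedI[OF that] continuous_mult]
    by (simp add: o_def)
  have "continuous_map T T (\<lambda>u. g \<otimes> u)"
    by (rule m[OF c[OF assms(1)]]) simp
  then have "continuous_map T T (\<lambda>u. g \<otimes> u \<otimes> inv g)"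
    by (rule m[OF _ c]) (use assms(1) in simp)
  from openin_continuous_map_preimage[OF this assms(2)] show ?thesis by (simp add: topspace_eq)
qed

lemma RUCB_ltrans:
  assumes f: "f \<in> RUCB G T" and g: "g \<in> carrier G"
  shows "ltrans G f g \<in> RUCB G T"
proof -
  obtain B where B: "\<forall>x\<in>carrier G. \<bar>f x\<bar> \<le> B" using f by (auto simp: RUCB_iff)
  have "\<exists>U. openin T U \<and> \<one> \<in> U \<and>
      (\<forall>h\<in>U. \<forall>x\<in>carrier G. \<bar>ltrans G f g x - ltrans G f g (h \<otimes> x)\<bar> \<le> \<epsilon>)"
    if "\<epsilon> > 0" for \<epsilon>
  proof -
    obtain U where U: "openin T U" "\<one> \<in> U"
        "\<And>h x. h \<in> U \<Longrightarrow> x \<in> carrier G \<Longrightarrow> \<bar>f x - f (h \<otimes> x)\<bar> \<le> \<epsilon>"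
      using RUCB_nbhd[OF f \<open>\<epsilon> > 0\<close>] by blast
    have "\<bar>ltrans G f g x - ltrans G f g (h \<otimes> x)\<bar> \<le> \<epsilon>"
      if h: "h \<in> {u \<in> carrier G. g \<otimes> u \<otimes> inv g \<in> U}" and x: "x \<in> carrier G" for h x
    proof -
      \<comment> \<open>The conjugate of \<open>h\<close> acting on \<open>g \<otimes> x\<close>
        yields \<open>g \<otimes> (h \<otimes> x)\<close>, so the choice of \<open>U\<close> can be
        applied at the point \<open>g \<otimes> x\<close>.\<close>
      have "(g \<otimes> h \<otimes> inv g) \<otimes> (g \<otimes> x) = g \<otimes> h \<otimes> (inv g \<otimes> (g \<otimes> x))"
        using g h x by (simp add: m_assoc)
      also have "\<dots> = g \<otimes> (h \<otimes> x)"
        using g h x m_assoc[of "inv g" g x] by (simp add: m_assoc)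
      finally show ?thesis using U(3)[of "g \<otimes> h \<otimes> inv g" "g \<otimes> x"] h x g by (simp add: ltrans_def)
    qed
    then show ?thesis using U openin_conjugate[OF g U(1)] g
      by (intro exI[of _ "{u \<in> carrier G. g \<otimes> u \<otimes> inv g \<in> U}"]) auto
  qed
  then show ?thesis using B g unfolding RUCB_iff by (auto simp: ltrans_def intro!: exI[of _ B])
qed

lemma ltrans_ltrans:
  "g \<in> carrier G \<Longrightarrow> h \<in> carrier G \<Longrightarrow> ltrans G (ltrans G f g) h = ltrans G f (g \<otimes> h)"
  by (auto simp: ltrans_def m_assoc intro!: restrict_ext)

lemma ltrans_one: "f \<in> extensional (carrier G) \<Longrightarrow> ltrans G f \<one> = f"
  by (auto simp: ltrans_def extensional_def)

section \<open>Linearity, monotonicity and contractivity of means\<close>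

lemma mean_add:
  "N \<in> means G T \<Longrightarrow> f \<in> RUCB G T \<Longrightarrow> g \<in> RUCB G T \<Longrightarrow> N (\<lambda>x\<in>carrier G. f x + g x) = N f + N g"
  by (simp add: means_def)

lemma mean_scale:
  "N \<in> means G T \<Longrightarrow> f \<in> RUCB G T \<Longrightarrow> N (\<lambda>x\<in>carrier G. a * f x) = a * N f"
  by (simp add: means_def)

lemma mean_const:
  assumes "N \<in> means G T" shows "N (\<lambda>x\<in>carrier G. c) = c"
proof -
  have "N (\<lambda>x\<in>carrier G. c) = N (\<lambda>x\<in>carrier G. c * (\<lambda>x\<in>carrier G. 1) x)"
    by (rule arg_cong[of _ _ N]) auto
  also have "\<dots> = c * N (\<lambda>x\<in>carrier G. 1)" by (rule mean_scale[OF assms RUCB_const])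
  also have "\<dots> = c" using assms by (simp add: means_def)
  finally show ?thesis .
qed

lemma mean_affine:
  assumes "N \<in> means G T" "f \<in> RUCB G T"
  shows "N (\<lambda>x\<in>carrier G. a * f x + b) = a * N f + b"
proof -
  have "N (\<lambda>x\<in>carrier G. a * f x + b) = N (\<lambda>x\<in>carrier G. (\<lambda>x\<in>carrier G. a * f x) x + (\<lambda>x\<in>carrier G. b) x)"
    by (rule arg_cong[of _ _ N]) auto
  also have "\<dots> = N (\<lambda>x\<in>carrier G. a * f x) + N (\<lambda>x\<in>carrier G. b)"
    by (rule mean_add[OF assms(1) RUCB_scale[OF assms(2)] RUCB_const])
  also have "\<dots> = a * N f + b" by (simp only: mean_scale[OF assms] mean_const[OF assms(1)])
  finally show ?thesis .
qed

lemma mean_mono: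
  assumes N: "supported_mean G T H N" and f: "f \<in> RUCB G T" and g: "g \<in> RUCB G T"
    and H: "H \<subseteq> carrier G" and le: "\<And>x. x \<in> H \<Longrightarrow> f x \<le> g x"
  shows "N f \<le> N g"
proof -
  have m: "N \<in> means G T" using N by (simp add: supported_mean_def)
  let ?h = "\<lambda>x\<in>carrier G. g x + (\<lambda>x\<in>carrier G. (-1) * f x) x"
  have "0 \<le> ?h x" if "x \<in> H" for x using that H le by auto
  moreover have "?h \<in> RUCB G T" by (intro RUCB_add[OF g] RUCB_scale[OF f])
  ultimately have "0 \<le> N ?h" using N by (auto simp only: supported_mean_def)
  also have "N ?h = N g + N (\<lambda>x\<in>carrier G. (-1) * f x)"
    by (rule mean_add[OF m g RUCB_scale[OF f]])
  also have "\<dots> = N g + (-1) * N f"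
    by (simp only: mean_scale[OF m f])
  finally show ?thesis by simp
qed

lemma mean_le:
  assumes "supported_mean G T H N" "f \<in> RUCB G T" "H \<subseteq> carrier G" "\<And>x. x \<in> H \<Longrightarrow> f x \<le> b"
  shows "N f \<le> b"
proof -
  have "N \<in> means G T" using assms(1) by (simp add: supported_mean_def)
  from mean_const[OF this, of b] show ?thesis
    using mean_mono[OF assms(1,2) RUCB_const[of b] assms(3)] assms(3,4) by (simp add: subset_iff)
qed

lemma mean_ge:
  assumes "supported_mean G T H N" "f \<in> RUCB G T" "H \<subseteq> carrier G" "\<And>x. x \<in> H \<Longrightarrow> b \<le> f x"
  shows "b \<le> N f"
proof -
  have "N \<in> means G T" using assms(1) by (simp add: supported_mean_def)
  from mean_const[OF this, of b] show ?thesis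
    using mean_mono[OF assms(1) RUCB_const[of b] assms(2,3)] assms(3,4) by (simp add: subset_iff)
qed

text \<open>Contractivity for the supremum norm: the hypothesis splits into
  \<open>f \<le> g + c\<close> and \<open>g \<le> f + c\<close>, and a mean is monotone and carries
  an added constant through unchanged.\<close>

lemma mean_dist_le:
  assumes N: "N \<in> means G T" and f: "f \<in> RUCB G T" and g: "g \<in> RUCB G T"
    and le: "\<And>x. x \<in> carrier G \<Longrightarrow> \<bar>f x - g x\<bar> \<le> c"
  shows "\<bar>N f - N g\<bar> \<le> c"
proof -
  have "N u \<le> N v + c"
    if "u \<in> RUCB G T" "v \<in> RUCB G T" "\<And>x. x \<in> carrier G \<Longrightarrow> u x \<le> v x + c" for u v
  proof -
    have "N u \<le> N (\<lambda>x\<in>carrier G. 1 * v x + c)"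
      by (rule mean_mono[OF supported_mean_carrier[OF N] that(1) RUCB_affine[OF that(2)] subset_refl])
        (use that(3) in simp)
    also have "\<dots> = 1 * N v + c" by (rule mean_affine[OF N that(2)])
    finally show ?thesis by simp
  qed
  moreover have "f x \<le> g x + c" "g x \<le> f x + c" if "x \<in> carrier G" for x
    using le[OF that] by (auto simp: abs_le_iff)
  ultimately have "N f \<le> N g + c" "N g \<le> N f + c" using f g by blast+
  then show ?thesis by (simp add: abs_le_iff)
qed

section \<open>The operator \<open>Phi\<close> and the convolution of means\<close>

text \<open>The two values are the same mean applied to two left translates, so contractivity
  applies. Taking \<open>y\<close> as a small left perturbation of \<open>x\<close> gives uniform
  continuity of \<open>Phi G N f\<close>; taking \<open>c\<close> as \<open>d x y\<close> gives its
  Lipschitz property.\<close>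

lemma Phi_le:
  assumes N: "N \<in> means G T" and f: "f \<in> RUCB G T" and x: "x \<in> carrier G" and y: "y \<in> carrier G"
    and le: "\<And>z. z \<in> carrier G \<Longrightarrow> \<bar>f (x \<otimes> z) - f (y \<otimes> z)\<bar> \<le> c"
  shows "\<bar>Phi G N f x - Phi G N f y\<bar> \<le> c"
  using mean_dist_le[OF N RUCB_ltrans[OF f x] RUCB_ltrans[OF f y], of c] le x y
  by (simp add: Phi_def ltrans_def)

text \<open>A neighbourhood that works for \<open>f\<close> works for \<open>Phi G N f\<close>: by
  associativity, perturbing \<open>x\<close> by \<open>h\<close> on the left perturbs every
  \<open>x \<otimes> z\<close> by the same \<open>h\<close>.\<close>

lemma RUCB_Phi:
  assumes N: "N \<in> means G T" and f: "f \<in> RUCB G T"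
  shows "Phi G N f \<in> RUCB G T"
proof -
  obtain B where B: "\<forall>x\<in>carrier G. \<bar>f x\<bar> \<le> B" using f by (auto simp: RUCB_iff)
  have bd: "\<bar>Phi G N f g\<bar> \<le> B" if "g \<in> carrier G" for g
  proof -
    have "- B \<le> ltrans G f g x" "ltrans G f g x \<le> B" if "x \<in> carrier G" for x
      using bspec[OF B, of "g \<otimes> x"] that \<open>g \<in> carrier G\<close> by (auto simp: ltrans_def abs_le_iff)
    then have "- B \<le> N (ltrans G f g)" "N (ltrans G f g) \<le> B"
      using supported_mean_carrier[OF N] RUCB_ltrans[OF f that] by (blast intro: mean_ge mean_le)+
    then show ?thesis using that by (simp add: Phi_def abs_le_iff)
  qed
  have "\<exists>U. openin T U \<and> \<one> \<in> U \<and>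
      (\<forall>h\<in>U. \<forall>x\<in>carrier G. \<bar>Phi G N f x - Phi G N f (h \<otimes> x)\<bar> \<le> \<epsilon>)"
    if "\<epsilon> > 0" for \<epsilon>
  proof -
    obtain U where U: "openin T U" "\<one> \<in> U"
        "\<And>h x. h \<in> U \<Longrightarrow> x \<in> carrier G \<Longrightarrow> \<bar>f x - f (h \<otimes> x)\<bar> \<le> \<epsilon>"
      using RUCB_nbhd[OF f \<open>\<epsilon> > 0\<close>] by blast
    have "\<bar>Phi G N f x - Phi G N f (h \<otimes> x)\<bar> \<le> \<epsilon>" if h: "h \<in> U" and x: "x \<in> carrier G" for h x
    proof -
      have "h \<in> carrier G" using h U(1) openin_carrier by blast
      then show ?thesis using x U(3)[OF h] by (intro Phi_le[OF N f]) (auto simp: m_assoc)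
    qed
    then show ?thesis using U by blast
  qed
  then show ?thesis using bd unfolding RUCB_iff by (auto simp: Phi_def intro!: exI[of _ B])
qed

lemma Phi_ltrans:
  assumes "g \<in> carrier G"
  shows "Phi G N (ltrans G f g) = ltrans G (Phi G N f) g"
proof -
  have "N (ltrans G (ltrans G f g) x) = Phi G N f (g \<otimes> x)" if "x \<in> carrier G" for x
    using assms that by (simp add: Phi_def ltrans_ltrans)
  then show ?thesis
    unfolding Phi_def[of G N "ltrans G f g"] ltrans_def[of G "Phi G N f"] by (auto intro!: restrict_ext)
qed

text \<open>Because \<open>Phi G P\<close> commutes with left translation, \<open>Phi\<close> turns
  convolution into composition. This is the recursion by which
  \<open>f\<^sub>i\<^sub>+\<^sub>1\<close> arises from \<open>f\<^sub>i\<close>.\<close>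

lemma Phi_conv:
  assumes "f \<in> RUCB G T"
  shows "Phi G (conv G T N P) f = Phi G N (Phi G P f)"
proof -
  have "conv G T N P (ltrans G f g) = N (ltrans G (Phi G P f) g)" if "g \<in> carrier G" for g
    using RUCB_ltrans[OF assms that] that by (simp add: conv_def Phi_ltrans)
  then show ?thesis unfolding Phi_def[of G "conv G T N P"] Phi_def[of G N] by (auto intro!: restrict_ext)
qed

text \<open>By facts \<open>1\<close> to \<open>4\<close>, the operator \<open>Phi G P\<close> is
  additive, homogeneous, positive and unital; composing it with the mean \<open>N\<close> preserves
  these properties.\<close>

lemma conv_in_means:
  assumes N: "N \<in> means G T" and P: "P \<in> means G T"
  shows "conv G T N P \<in> means G T"
proof -
  have 1: "Phi G P (\<lambda>x\<in>carrier G. f x + g x) = (\<lambda>x\<in>carrier G. Phi G P f x + Phi G P g x)"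
    if f: "f \<in> RUCB G T" and g: "g \<in> RUCB G T" for f g
  proof -
    have "P (ltrans G (\<lambda>x\<in>carrier G. f x + g x) z) = P (ltrans G f z) + P (ltrans G g z)"
      if z: "z \<in> carrier G" for z
    proof -
      have "P (ltrans G (\<lambda>x\<in>carrier G. f x + g x) z) = P (\<lambda>x\<in>carrier G. ltrans G f z x + ltrans G g z x)"
        using z by (intro arg_cong[of _ _ P]) (auto simp: ltrans_def intro!: restrict_ext)
      also have "\<dots> = P (ltrans G f z) + P (ltrans G g z)"
        using f g z by (intro mean_add[OF P] RUCB_ltrans)
      finally show ?thesis .
    qed
    then show ?thesis by (auto simp: Phi_def intro!: restrict_ext)
  qed
  have 2: "Phi G P (\<lambda>x\<in>carrier G. c * f x) = (\<lambda>x\<in>carrier G. c * Phi G P f x)"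
    if f: "f \<in> RUCB G T" for f c
  proof -
    have "P (ltrans G (\<lambda>x\<in>carrier G. c * f x) z) = c * P (ltrans G f z)"
      if z: "z \<in> carrier G" for z
    proof -
      have "P (ltrans G (\<lambda>x\<in>carrier G. c * f x) z) = P (\<lambda>x\<in>carrier G. c * ltrans G f z x)"
        using z by (intro arg_cong[of _ _ P]) (auto simp: ltrans_def intro!: restrict_ext)
      also have "\<dots> = c * P (ltrans G f z)"
        using f z by (intro mean_scale[OF P] RUCB_ltrans)
      finally show ?thesis .
    qed
    then show ?thesis by (auto simp: Phi_def intro!: restrict_ext)
  qed
  have 3: "0 \<le> Phi G P f x" if "f \<in> RUCB G T" "\<forall>x\<in>carrier G. 0 \<le> f x" "x \<in> carrier G" for f x
    using mean_ge[OF supported_mean_carrier[OF P] RUCB_ltrans, of f x 0] that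
    by (simp add: Phi_def ltrans_def)
  have 4: "Phi G P (\<lambda>x\<in>carrier G. 1) = (\<lambda>x\<in>carrier G. 1)"
  proof -
    have "ltrans G (\<lambda>x\<in>carrier G. 1) z = (\<lambda>x\<in>carrier G. 1)" if "z \<in> carrier G" for z
      using that by (auto simp: ltrans_def intro!: restrict_ext)
    then show ?thesis using mean_const[OF P] by (auto simp: Phi_def intro!: restrict_ext)
  qed
  show ?thesis
    unfolding means_def
    using 1 2 3 4 RUCB_add RUCB_scale RUCB_const[of 1] RUCB_Phi[OF P]
      mean_add[OF N] mean_scale[OF N] mean_const[OF N]
      mean_ge[OF supported_mean_carrier[OF N], of _ 0]
    by (simp add: conv_def)
qed

lemma eval_one_in_means: "(\<lambda>f\<in>RUCB G T. f \<one>) \<in> means G T"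
  using RUCB_add RUCB_scale RUCB_const[of 1] by (simp add: means_def)

text \<open>The base \<open>f\<^sub>0 = f\<close> of the recursion. Equality as HOL functions rests
  on the extensionality of \<open>f\<close>, which absorbs the restriction in
  \<open>Phi\<close>.\<close>

lemma Phi_eval_one:
  assumes f: "f \<in> RUCB G T"
  shows "Phi G (\<lambda>f\<in>RUCB G T. f \<one>) f = f"
proof -
  have "(\<lambda>f\<in>RUCB G T. f \<one>) (ltrans G f g) = f g" if g: "g \<in> carrier G" for g
  proof -
    have "ltrans G f g \<one> = f g" using g by (simp add: ltrans_def)
    then show ?thesis using RUCB_ltrans[OF f g] by simp
  qed
  then have "Phi G (\<lambda>f\<in>RUCB G T. f \<one>) f = restrict f (carrier G)"
    unfolding Phi_def by (rule restrict_ext)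
  then show ?thesis using f by (simp add: RUCB_iff extensional_restrict)
qed

section \<open>Means embedded from subgroups and their invariance\<close>

lemma RUCB_restrict:
  assumes H: "subgroup H G" and f: "f \<in> RUCB G T"
  shows "restrict f H \<in> RUCB (G\<lparr>carrier := H\<rparr>) (subtopology T H)"
proof -
  interpret H: subgroup H G by fact
  obtain B where B: "\<forall>x\<in>carrier G. \<bar>f x\<bar> \<le> B" using f by (auto simp: RUCB_iff)
  have "\<exists>U. openin (subtopology T H) U \<and> \<one> \<in> U \<and>
      (\<forall>h\<in>U. \<forall>x\<in>H. \<bar>f x - ltrans (G\<lparr>carrier := H\<rparr>) (restrict f H) h x\<bar> \<le> \<epsilon>)"
    if "\<epsilon> > 0" for \<epsilon>
  proof -
    obtain U where U: "openin T U" "\<one> \<in> U"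
        "\<And>h x. h \<in> U \<Longrightarrow> x \<in> carrier G \<Longrightarrow> \<bar>f x - f (h \<otimes> x)\<bar> \<le> \<epsilon>"
      using RUCB_nbhd[OF f \<open>\<epsilon> > 0\<close>] by blast
    then show ?thesis
      by (intro exI[of _ "U \<inter> H"]) (auto simp: ltrans_def openin_subtopology)
  qed
  then show ?thesis using B by (auto simp: RUCB_def bounded_iff intro!: exI[of _ B])
qed

text \<open>The embedded mean sees only the restriction to \<open>H\<close>, so positivity can be
  tested there. Invariance carries over because restriction to \<open>H\<close> commutes with
  translation by elements of \<open>H\<close>.\<close>

lemma mean_embed_invariant:
  assumes H: "subgroup H G"
    and \<nu>: "left_invariant_mean (G\<lparr>carrier := H\<rparr>) (subtopology T H) H \<nu>"
  shows "supported_mean G T H (mean_embed G T H \<nu>)"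
    and "left_invariant_mean G T H (mean_embed G T H \<nu>)"
proof -
  interpret H: subgroup H G by fact
  let ?N = "mean_embed G T H \<nu>"
  have m: "\<nu> \<in> means (G\<lparr>carrier := H\<rparr>) (subtopology T H)"
    using \<nu> by (simp add: left_invariant_mean_def)
  have eq: "restrict (\<lambda>x\<in>carrier G. p x) H = (\<lambda>x\<in>H. p x)" for p :: "'a \<Rightarrow> real"
    by (auto intro!: restrict_ext)
  have N: "?N f = \<nu> (restrict f H)" if "f \<in> RUCB G T" for f
    using that by (simp add: mean_embed_def)
  have add: "?N (\<lambda>x\<in>carrier G. f x + g x) = ?N f + ?N g" if "f \<in> RUCB G T" "g \<in> RUCB G T" for f g
  proof -
    have "?N (\<lambda>x\<in>carrier G. f x + g x) = \<nu> (\<lambda>x\<in>H. f x + g x)"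
      by (simp only: N[OF RUCB_add[OF that]] eq)
    also have "(\<lambda>x\<in>H. f x + g x) = (\<lambda>x\<in>H. restrict f H x + restrict g H x)" by auto
    also have "\<nu> \<dots> = \<nu> (restrict f H) + \<nu> (restrict g H)"
      using m RUCB_restrict[OF H that(1)] RUCB_restrict[OF H that(2)] by (simp add: means_def del: restrict_apply)
    also have "\<dots> = ?N f + ?N g" by (simp only: N that)
    finally show ?thesis .
  qed
  have scale: "?N (\<lambda>x\<in>carrier G. c * f x) = c * ?N f" if "f \<in> RUCB G T" for f c
  proof -
    have "?N (\<lambda>x\<in>carrier G. c * f x) = \<nu> (\<lambda>x\<in>H. c * f x)"
      by (simp only: N[OF RUCB_scale[OF that]] eq)
    also have "(\<lambda>x\<in>H. c * f x) = (\<lambda>x\<in>H. c * restrict f H x)" by auto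
    also have "\<nu> \<dots> = c * \<nu> (restrict f H)"
      using m RUCB_restrict[OF H that] by (simp add: means_def del: restrict_apply)
    also have "\<dots> = c * ?N f" by (simp only: N that)
    finally show ?thesis .
  qed
  have nonneg: "0 \<le> ?N f" if "f \<in> RUCB G T" "\<And>x. x \<in> H \<Longrightarrow> 0 \<le> f x" for f
    using m RUCB_restrict[OF H] that by (simp add: N means_def)
  have one: "?N (\<lambda>x\<in>carrier G. 1) = 1"
  proof -
    have "?N (\<lambda>x\<in>carrier G. 1) = \<nu> (\<lambda>x\<in>H. 1)" by (simp only: N[OF RUCB_const] eq)
    also have "\<dots> = 1" using m by (simp add: means_def)
    finally show ?thesis .
  qed
  have mean: "?N \<in> means G T"
    unfolding means_def using add scale nonneg one by (auto simp: mean_embed_def)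
  then show "supported_mean G T H ?N" using nonneg by (simp add: supported_mean_def)
  have "?N (ltrans G f h) = ?N f" if f: "f \<in> RUCB G T" and h: "h \<in> H" for f h
  proof -
    have "restrict (ltrans G f h) H = ltrans (G\<lparr>carrier := H\<rparr>) (restrict f H) h"
      using h by (auto simp: ltrans_def intro!: restrict_ext)
    then show ?thesis
      using \<nu> RUCB_restrict[OF H f] RUCB_ltrans[OF f, of h] f h
      by (simp add: N left_invariant_mean_def)
  qed
  with mean show "left_invariant_mean G T H ?N" by (simp add: left_invariant_mean_def)
qed

text \<open>Translating by \<open>g\<close> and then by \<open>h\<close> is translating by
  \<open>g \<otimes> h\<close>, so left invariance of \<open>N\<close> under \<open>h\<close>
  becomes right invariance of \<open>Phi G N f\<close>, that is, constancy on left cosets of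
  \<open>H\<close>.\<close>

lemma Phi_right_invariant:
  assumes "left_invariant_mean G T H N" "H \<subseteq> carrier G" "f \<in> RUCB G T" "g \<in> carrier G" "h \<in> H"
  shows "Phi G N f (g \<otimes> h) = Phi G N f g"
proof -
  have h: "h \<in> carrier G" using assms by auto
  have "N (ltrans G (ltrans G f g) h) = N (ltrans G f g)"
    using assms RUCB_ltrans[of f g] by (simp add: left_invariant_mean_def)
  then show ?thesis using assms(4) h by (simp add: Phi_def ltrans_ltrans)
qed

section \<open>Exponential estimate for one averaging step\<close>

text \<open>An analogue of Hoeffding's lemma for means. On \<open>H\<close> the translate
  \<open>F\<close> stays within \<open>c\<close> of its average \<open>a\<close>, so
  \<open>exp\<close> is bounded by its chord over an interval of radius \<open>C\<close>; the linear
  part of the chord averages to zero and \<open>cosh C\<close> remains. The symmetric interval has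
  length \<open>2 * C\<close>, whence the denominator 2.\<close>

lemma Phi_exp_le:
  assumes N: "supported_mean G T H N" and H: "subgroup H G"
    and f: "f \<in> RUCB G T" and g: "g \<in> carrier G"
    and osc: "\<And>x y. x \<in> H \<Longrightarrow> y \<in> H \<Longrightarrow> \<bar>f (g \<otimes> x) - f (g \<otimes> y)\<bar> \<le> c"
  shows "Phi G N (\<lambda>x\<in>carrier G. exp (t * f x)) g \<le> exp (t * Phi G N f g + t\<^sup>2 * c\<^sup>2 / 2)"
proof -
  interpret H: subgroup H G by fact
  have sub: "H \<subseteq> carrier G" by (rule H.subset)
  define F where "F = ltrans G f g"
  define a where "a = N F"
  define C where "C = \<bar>t\<bar> * c"
  define s where "s = sinh C / C"
  have m: "N \<in> means G T" using N by (simp add: supported_mean_def)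
  have F: "F \<in> RUCB G T" unfolding F_def by (rule RUCB_ltrans[OF f g])
  have Fx: "F x = f (g \<otimes> x)" if "x \<in> H" for x using that sub by (auto simp: F_def ltrans_def)
  have dev: "\<bar>t * F x - t * a\<bar> \<le> C" if x: "x \<in> H" for x
  proof -
    \<comment> \<open>With \<open>x\<close> fixed, every value of \<open>F\<close> on
      \<open>H\<close> lies within \<open>c\<close> of \<open>F x\<close>, hence so does the average
      \<open>a\<close>.\<close>
    have "F x - c \<le> a" unfolding a_def
      by (rule mean_ge[OF N F sub]) (use osc[OF x] Fx x in fastforce)
    moreover have "a \<le> F x + c" unfolding a_def
      by (rule mean_le[OF N F sub]) (use osc[OF x] Fx x in fastforce)
    ultimately have "\<bar>F x - a\<bar> \<le> c" by (simp add: abs_le_iff)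
    then have "\<bar>t\<bar> * \<bar>F x - a\<bar> \<le> C" unfolding C_def by (intro mult_left_mono) auto
    then show ?thesis by (simp add: right_diff_distrib flip: abs_mult)
  qed
  let ?E = "\<lambda>x\<in>carrier G. exp (t * F x)"
  \<comment> \<open>The chord bound for \<open>t * F x - t * a\<close>, multiplied by
    \<open>exp (t * a)\<close> and regrouped as an affine function of \<open>F\<close>, so that its
    mean can be computed.\<close>
  let ?A = "\<lambda>x\<in>carrier G. (exp (t * a) * s * t) * F x + exp (t * a) * (cosh C - s * (t * a))"
  have "ltrans G (\<lambda>x\<in>carrier G. exp (t * f x)) g = ?E"
    using g by (auto simp: F_def ltrans_def intro!: restrict_ext)
  then have "Phi G N (\<lambda>x\<in>carrier G. exp (t * f x)) g = N ?E" using g by (simp add: Phi_def)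
  also have "\<dots> \<le> N ?A"
  proof (rule mean_mono[OF N RUCB_exp[OF F] RUCB_affine[OF F] sub])
    fix x assume x: "x \<in> H"
    have "exp (t * F x) = exp (t * a) * exp (t * F x - t * a)" by (simp flip: exp_add)
    also have "\<dots> \<le> exp (t * a) * (cosh C + s * (t * F x - t * a))"
      unfolding s_def by (intro mult_left_mono exp_le_chord dev x) auto
    finally show "?E x \<le> ?A x" using x sub by (simp add: algebra_simps)
  qed
  also have "\<dots> = exp (t * a) * cosh C"
    unfolding mean_affine[OF m F] a_def[symmetric] by (simp add: algebra_simps)
  also have "\<dots> \<le> exp (t * a) * exp (C\<^sup>2 / 2)"
    by (intro mult_left_mono cosh_le_exp_sq) auto
  also have "\<dots> = exp (t * Phi G N f g + t\<^sup>2 * c\<^sup>2 / 2)"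
    using g by (simp add: C_def a_def F_def Phi_def power_mult_distrib flip: exp_add)
  finally show ?thesis .
qed

section \<open>Points of the Samuel compactification as means\<close>

text \<open>A nonnegative \<open>f\<close> is the square of its square root, which again lies in
  \<open>RUCB\<close>; a multiplicative functional sends it to a square of a real number.\<close>

lemma samuel_nonneg:
  assumes \<xi>: "\<xi> \<in> samuel G T" and f: "f \<in> RUCB G T" and nonneg: "\<And>x. x \<in> carrier G \<Longrightarrow> 0 \<le> f x"
  shows "0 \<le> \<xi> f"
proof -
  let ?r = "\<lambda>x\<in>carrier G. sqrt (f x)"
  have r: "?r \<in> RUCB G T" using f by (rule RUCB_compose) (intro continuous_intros)
  have "\<xi> f = \<xi> (\<lambda>x\<in>carrier G. ?r x * ?r x)"
    using f nonneg by (intro arg_cong[of _ _ \<xi>]) (auto simp: RUCB_iff extensional_def)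
  also have "\<dots> = \<xi> ?r * \<xi> ?r" using \<xi> r unfolding samuel_def by blast
  finally have "\<xi> f = \<xi> ?r * \<xi> ?r" .
  then show ?thesis by simp
qed

text \<open>Real homogeneity has to be recovered from the ring structure: scaling by
  \<open>c\<close> is multiplication by a constant function, and constants are fixed since the
  induced map on the reals is additive, positive and unital.\<close>

lemma samuel_subset_means: "samuel G T \<subseteq> means G T"
proof
  fix \<xi> assume \<xi>: "\<xi> \<in> samuel G T"
  have const: "\<xi> (\<lambda>x\<in>carrier G. c) = c" for c
  proof (rule additive_nonneg_imp_id[of "\<lambda>c. \<xi> (\<lambda>x\<in>carrier G. c)"])
    fix p q :: real
    have "\<xi> (\<lambda>x\<in>carrier G. p + q) = \<xi> (\<lambda>x\<in>carrier G. (\<lambda>x\<in>carrier G. p) x + (\<lambda>x\<in>carrier G. q) x)"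
      by (rule arg_cong[of _ _ \<xi>]) auto
    also have "\<dots> = \<xi> (\<lambda>x\<in>carrier G. p) + \<xi> (\<lambda>x\<in>carrier G. q)"
      using \<xi> RUCB_const[of p] RUCB_const[of q] unfolding samuel_def by blast
    finally show "\<xi> (\<lambda>x\<in>carrier G. p + q) = \<xi> (\<lambda>x\<in>carrier G. p) + \<xi> (\<lambda>x\<in>carrier G. q)" .
  next
    show "0 \<le> \<xi> (\<lambda>x\<in>carrier G. p)" if "0 \<le> p" for p
      by (rule samuel_nonneg[OF \<xi> RUCB_const]) (use that in simp)
  qed (use \<xi> in \<open>simp add: samuel_def\<close>)
  have "\<xi> (\<lambda>x\<in>carrier G. c * f x) = c * \<xi> f" if "f \<in> RUCB G T" for c f
  proof -
    have "\<xi> (\<lambda>x\<in>carrier G. c * f x) = \<xi> (\<lambda>x\<in>carrier G. (\<lambda>x\<in>carrier G. c) x * f x)"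
      by (rule arg_cong[of _ _ \<xi>]) auto
    also have "\<dots> = \<xi> (\<lambda>x\<in>carrier G. c) * \<xi> f"
      using \<xi> that RUCB_const[of c] unfolding samuel_def by blast
    finally show ?thesis by (simp add: const)
  qed
  then show "\<xi> \<in> means G T" using \<xi> samuel_nonneg[OF \<xi>] by (simp add: means_def samuel_def)
qed

text \<open>The tangent line of \<open>exp\<close> at \<open>t * N f\<close> gives the bound.\<close>

lemma exp_mean_le:
  assumes N: "N \<in> means G T" and f: "f \<in> RUCB G T"
  shows "exp (t * N f) \<le> N (\<lambda>x\<in>carrier G. exp (t * f x))"
proof -
  define a where "a = t * N f"
  have "exp a = (exp a * t) * N f + exp a * (1 - a)"
    by (simp add: a_def algebra_simps)
  also have "\<dots> = N (\<lambda>x\<in>carrier G. (exp a * t) * f x + exp a * (1 - a))"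
    by (rule mean_affine[OF N f, symmetric])
  also have "\<dots> \<le> N (\<lambda>x\<in>carrier G. exp (t * f x))"
  proof (rule mean_mono[OF supported_mean_carrier[OF N] RUCB_affine[OF f] RUCB_exp[OF f] subset_refl])
    fix x assume x: "x \<in> carrier G"
    have "exp a * (1 + (t * f x - a)) \<le> exp a * exp (t * f x - a)"
      by (intro mult_left_mono exp_ge_add_one_self) auto
    also have "\<dots> = exp (t * f x)" by (simp flip: exp_add)
    finally show "(\<lambda>x\<in>carrier G. (exp a * t) * f x + exp a * (1 - a)) x
        \<le> (\<lambda>x\<in>carrier G. exp (t * f x)) x" using x by (simp add: algebra_simps)
  qed
  finally show ?thesis by (simp add: a_def)
qed

section \<open>Lipschitz functions and oscillation on cosets\<close>

text \<open>Right invariance gives \<open>d x (g \<otimes> x) = d \<one> g\<close>, so one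
  \<open>d\<close>-ball around the identity serves all \<open>x\<close> at once. Boundedness of
  \<open>f\<close> comes from that of \<open>d\<close>.\<close>

lemma Lip1_subset_RUCB:
  assumes d: "pseudo_metric_on (carrier G) d" and bd: "bounded_pseudo_metric (carrier G) d"
    and cont: "continuous_pseudo_metric T d" and ri: "right_invariant G d"
  shows "Lip1 G d \<subseteq> RUCB G T"
proof
  fix f assume f: "f \<in> Lip1 G d"
  obtain B where B: "\<And>x y. x \<in> carrier G \<Longrightarrow> y \<in> carrier G \<Longrightarrow> d x y \<le> B"
    using bd by (auto simp: bounded_pseudo_metric_def)
  have L: "\<bar>f x - f y\<bar> \<le> d x y" if "x \<in> carrier G" "y \<in> carrier G" for x y
    using f that by (auto simp: Lip1_def)
  have bdd: "\<bar>f x\<bar> \<le> \<bar>f \<one>\<bar> + B" if "x \<in> carrier G" for x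
    using L[OF that one_closed] B[OF that one_closed] by linarith
  have "\<exists>U. openin T U \<and> \<one> \<in> U \<and> (\<forall>g\<in>U. \<forall>x\<in>carrier G. \<bar>f x - f (g \<otimes> x)\<bar> \<le> \<epsilon>)"
    if "\<epsilon> > 0" for \<epsilon>
  proof (intro exI conjI ballI)
    let ?U = "{y \<in> carrier G. d \<one> y < \<epsilon>}"
    have "openin (pseudo_metric_topology (carrier G) d) ?U"
      unfolding pseudo_metric_topology_def
      by (rule topology_generated_by_Basis) (use that in blast)
    then show "openin T ?U" using cont by (simp add: continuous_pseudo_metric_def topspace_eq)
    show "\<one> \<in> ?U" using d that by (simp add: pseudo_metric_on_def)
    fix g x assume g: "g \<in> ?U" and x: "x \<in> carrier G"
    have "\<bar>f x - f (g \<otimes> x)\<bar> \<le> d (\<one> \<otimes> x) (g \<otimes> x)" using L[of x "g \<otimes> x"] g x by simp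
    also have "\<dots> = d \<one> g" using ri g x unfolding right_invariant_def by blast
    also have "\<dots> \<le> \<epsilon>" using g by simp
    finally show "\<bar>f x - f (g \<otimes> x)\<bar> \<le> \<epsilon>" .
  qed
  moreover have "\<exists>B. \<forall>x\<in>carrier G. \<bar>f x\<bar> \<le> B" using bdd by blast
  ultimately show "f \<in> RUCB G T" using f unfolding RUCB_iff Lip1_def by blast
qed

text \<open>Right invariance makes the Lipschitz bound between \<open>x \<otimes> z\<close> and
  \<open>y \<otimes> z\<close> independent of \<open>z\<close>, so it survives averaging over
  \<open>z\<close>.\<close>

lemma Phi_Lip1:
  assumes "N \<in> means G T" "f \<in> RUCB G T" "f \<in> Lip1 G d" "right_invariant G d"
  shows "Phi G N f \<in> Lip1 G d"
proof -
  have "\<bar>Phi G N f x - Phi G N f y\<bar> \<le> d x y" if "x \<in> carrier G" "y \<in> carrier G" for x y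
  proof (rule Phi_le[OF assms(1,2) that])
    fix z assume z: "z \<in> carrier G"
    have "\<bar>f (x \<otimes> z) - f (y \<otimes> z)\<bar> \<le> d (x \<otimes> z) (y \<otimes> z)"
      using assms(3) that z by (simp add: Lip1_def)
    also have "\<dots> = d x y" using assms(4) that z by (simp add: right_invariant_def)
    finally show "\<bar>f (x \<otimes> z) - f (y \<otimes> z)\<bar> \<le> d x y" .
  qed
  then show ?thesis by (simp add: Lip1_def Phi_def)
qed

text \<open>Since \<open>f\<close> is constant on left cosets of \<open>H\<close>, the
  representatives of both cosets may be varied freely before the Lipschitz bound is applied; the
  infimum over them is the coset distance. Boundedness of \<open>d\<close> ensures that the suprema
  over the reals are genuine upper bounds.\<close>

lemma oscillation_le:
  assumes d: "pseudo_metric_on (carrier G) d" and bd: "bounded_pseudo_metric (carrier G) d"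
    and H: "subgroup H G" and H': "subgroup H' G"
    and f: "f \<in> Lip1 G d" and inv: "\<And>g h. g \<in> carrier G \<Longrightarrow> h \<in> H \<Longrightarrow> f (g \<otimes> h) = f g"
    and g: "g \<in> carrier G" and x: "x \<in> H'" and y: "y \<in> H'"
  shows "\<bar>f (g \<otimes> x) - f (g \<otimes> y)\<bar>
    \<le> (SUP g\<in>carrier G. pdiam (lcosets\<^bsub>G\<lparr>carrier := H'\<rparr>\<^esub> H) (coset_pdist G d g))"
proof -
  interpret H: subgroup H G by fact
  interpret H': subgroup H' G by fact
  obtain B where B: "\<And>x y. x \<in> carrier G \<Longrightarrow> y \<in> carrier G \<Longrightarrow> d x y \<le> B"
    using bd by (auto simp: bounded_pseudo_metric_def)
  have nonneg: "0 \<le> d x y" if "x \<in> carrier G" "y \<in> carrier G" for x y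
    using d that by (simp add: pseudo_metric_on_def)
  let ?L = "lcosets\<^bsub>G\<lparr>carrier := H'\<rparr>\<^esub> H"
  have Hne: "H \<noteq> {}" using H.one_closed by blast
  have L: "A \<subseteq> carrier G \<and> A \<noteq> {}" if "A \<in> ?L" for A
    using that Hne by (auto simp: LCOSETS_def l_coset_def)
  have in_L: "z <#\<^bsub>G\<^esub> H \<in> ?L" if "z \<in> H'" for z
    using that by (auto simp: LCOSETS_def l_coset_def)
  have ub: "coset_pdist G d k A C \<le> B" if A: "A \<in> ?L" and C: "C \<in> ?L" and k: "k \<in> carrier G" for k A C
  proof -
    obtain a c where ac: "a \<in> A" "c \<in> C" "a \<in> carrier G" "c \<in> carrier G"
      using L[OF A] L[OF C] by blast
    have "coset_pdist G d k A C \<le> (case (a, c) of (x, y) \<Rightarrow> d (k \<otimes> x) (k \<otimes> y))"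
      unfolding coset_pdist_def
    proof (rule cINF_lower)
      show "bdd_below ((\<lambda>(x, y). d (k \<otimes> x) (k \<otimes> y)) ` (A \<times> C))"
        using L[OF A] L[OF C] k by (intro bdd_belowI2[of _ 0]) (auto intro!: nonneg)
    qed (use ac in auto)
    also have "\<dots> \<le> B" using ac k by (auto intro!: B)
    finally show ?thesis .
  qed
  have ne: "?L \<times> ?L \<noteq> {}" using in_L[OF H'.one_closed] by auto
  have ub2: "pdiam ?L (coset_pdist G d k) \<le> B" if "k \<in> carrier G" for k
    unfolding pdiam_def by (rule cSUP_least[OF ne]) (use ub that in auto)
  have "\<bar>f (g \<otimes> x) - f (g \<otimes> y)\<bar> \<le> coset_pdist G d g (x <#\<^bsub>G\<^esub> H) (y <#\<^bsub>G\<^esub> H)"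
    unfolding coset_pdist_def
  proof (rule cINF_greatest)
    show "(x <#\<^bsub>G\<^esub> H) \<times> (y <#\<^bsub>G\<^esub> H) \<noteq> {}" using L[OF in_L[OF x]] L[OF in_L[OF y]] by auto
    fix p assume "p \<in> (x <#\<^bsub>G\<^esub> H) \<times> (y <#\<^bsub>G\<^esub> H)"
    then obtain h k where p: "p = (x \<otimes> h, y \<otimes> k)" and hk: "h \<in> H" "k \<in> H"
      by (auto simp: l_coset_def)
    have "\<bar>f (g \<otimes> x \<otimes> h) - f (g \<otimes> y \<otimes> k)\<bar> \<le> d (g \<otimes> x \<otimes> h) (g \<otimes> y \<otimes> k)"
      using f g x y hk by (simp add: Lip1_def)
    moreover have "f (g \<otimes> x \<otimes> h) = f (g \<otimes> x)" "f (g \<otimes> y \<otimes> k) = f (g \<otimes> y)"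
      using inv g x y hk by simp_all
    ultimately have "\<bar>f (g \<otimes> x) - f (g \<otimes> y)\<bar> \<le> d (g \<otimes> x \<otimes> h) (g \<otimes> y \<otimes> k)" by simp
    moreover have "g \<otimes> x \<otimes> h = g \<otimes> (x \<otimes> h)" "g \<otimes> y \<otimes> k = g \<otimes> (y \<otimes> k)"
      using g x y hk by (simp_all add: m_assoc)
    ultimately show "\<bar>f (g \<otimes> x) - f (g \<otimes> y)\<bar> \<le> (case p of (x, y) \<Rightarrow> d (g \<otimes> x) (g \<otimes> y))"
      by (simp add: p)
  qed
  also have "\<dots> = (\<lambda>(a, b). coset_pdist G d g a b) (x <#\<^bsub>G\<^esub> H, y <#\<^bsub>G\<^esub> H)" by simp
  also have "\<dots> \<le> pdiam ?L (coset_pdist G d g)"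
    unfolding pdiam_def
  proof (rule cSUP_upper)
    show "bdd_above ((\<lambda>(a, b). coset_pdist G d g a b) ` (?L \<times> ?L))"
      using ub g by (intro bdd_aboveI2[of _ _ B]) auto
  qed (use in_L x y in auto)
  also have "\<dots> \<le> (SUP g\<in>carrier G. pdiam ?L (coset_pdist G d g))"
    using ub2 by (intro cSUP_upper g bdd_aboveI2[of _ _ B]) auto
  finally show ?thesis .
qed

section \<open>Induction along the chain of subgroups\<close>

text \<open>The induction carries three facts: \<open>\<mu> i\<close> is a mean,
  \<open>f\<^sub>i\<close> is constant on left cosets of \<open>K i\<close>, and the exponential
  bound holds at every point \<open>g\<close>. The bound is kept pointwise because the next step
  averages it over translates.\<close>

lemma conv_prod_exp_le:
  fixes K :: "nat \<Rightarrow> 'a set"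
  assumes K0: "K 0 = {\<one>}"
    and sub: "\<And>i. i \<le> n \<Longrightarrow> subgroup (K i) G"
    and inv: "\<And>i. i \<in> {1..n} \<Longrightarrow>
           left_invariant_mean (G\<lparr>carrier := K i\<rparr>) (subtopology T (K i)) (K i) (\<nu> i)"
    and d: "pseudo_metric_on (carrier G) d" and bd: "bounded_pseudo_metric (carrier G) d"
    and cont: "continuous_pseudo_metric T d" and ri: "right_invariant G d"
    and f: "f \<in> Lip1 G d"
  defines "\<mu> \<equiv> conv_prod G T (\<lambda>i. mean_embed G T (K i) (\<nu> i))"
  shows "\<mu> n \<in> means G T"
    and "\<mu> n (\<lambda>x\<in>carrier G. exp (t * f x)) \<le> exp (t * \<mu> n f + t\<^sup>2 * (chain_length G K n d)\<^sup>2 / 2)"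
proof -
  define c where "c i = (SUP g\<in>carrier G.
      pdiam (lcosets\<^bsub>G\<lparr>carrier := K (Suc i)\<rparr>\<^esub> (K i)) (coset_pdist G d g))" for i
  have fR: "f \<in> RUCB G T" using Lip1_subset_RUCB[OF d bd cont ri] f by blast
  let ?e = "\<lambda>x\<in>carrier G. exp (t * f x)"
  have eR: "?e \<in> RUCB G T" using fR by (rule RUCB_exp)
  have "i \<le> n \<Longrightarrow> \<mu> i \<in> means G T \<and>
      (\<forall>g\<in>carrier G. \<forall>h\<in>K i. Phi G (\<mu> i) f (g \<otimes> h) = Phi G (\<mu> i) f g) \<and>
      (\<forall>g\<in>carrier G. Phi G (\<mu> i) ?e g \<le> exp (t * Phi G (\<mu> i) f g + t\<^sup>2 * (\<Sum>j<i. (c j)\<^sup>2) / 2))" for i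
  proof (induction i)
    case 0
    have \<mu>: "\<mu> 0 = (\<lambda>f\<in>RUCB G T. f \<one>)" by (simp add: \<mu>_def)
    have *: "Phi G (\<mu> 0) f = f" "Phi G (\<mu> 0) ?e = ?e" "\<mu> 0 \<in> means G T"
      unfolding \<mu> by (intro Phi_eval_one fR eR eval_one_in_means)+
    show ?case unfolding *(1,2) using *(3) by (simp add: K0)
  next
    case (Suc i)
    define N where "N = mean_embed G T (K (Suc i)) (\<nu> (Suc i))"
    define F where "F = Phi G (\<mu> i) f"
    have \<mu>: "\<mu> (Suc i) = conv G T N (\<mu> i)" by (simp add: \<mu>_def N_def)
    have IH: "\<mu> i \<in> means G T" "\<And>g h. g \<in> carrier G \<Longrightarrow> h \<in> K i \<Longrightarrow> F (g \<otimes> h) = F g"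
      "\<And>g. g \<in> carrier G \<Longrightarrow> Phi G (\<mu> i) ?e g \<le> exp (t * F g + t\<^sup>2 * (\<Sum>j<i. (c j)\<^sup>2) / 2)"
      using Suc.IH Suc.prems unfolding F_def by (meson Suc_leD)+
    note sg = sub[OF Suc.prems]
    have sgi: "subgroup (K i) G" using Suc.prems sub by simp
    have Kc: "K (Suc i) \<subseteq> carrier G" using sg subgroup.subset by blast
    have "left_invariant_mean (G\<lparr>carrier := K (Suc i)\<rparr>) (subtopology T (K (Suc i))) (K (Suc i)) (\<nu> (Suc i))"
      using inv Suc.prems by simp
    note N = mean_embed_invariant[OF sg this, folded N_def]
    have Nm: "N \<in> means G T" using N(1) by (simp add: supported_mean_def)
    have FR: "F \<in> RUCB G T" unfolding F_def by (rule RUCB_Phi[OF IH(1) fR])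
    have FL: "F \<in> Lip1 G d" unfolding F_def by (rule Phi_Lip1[OF IH(1) fR f ri])
    have step: "Phi G (\<mu> (Suc i)) ?e g
        \<le> exp (t * Phi G (\<mu> (Suc i)) f g + t\<^sup>2 * (\<Sum>j<Suc i. (c j)\<^sup>2) / 2)" if g: "g \<in> carrier G" for g
    proof -
      let ?q = "t\<^sup>2 * (\<Sum>j<i. (c j)\<^sup>2) / 2"
      let ?E = "\<lambda>x\<in>carrier G. exp (t * F x)"
      have ER: "?E \<in> RUCB G T" using FR by (rule RUCB_exp)
      have "Phi G (\<mu> (Suc i)) ?e g = N (ltrans G (Phi G (\<mu> i) ?e) g)"
        using g by (simp add: \<mu> Phi_conv[OF eR] Phi_def[of G N])
      \<comment> \<open>The induction bound is applied at each \<open>g \<otimes> x\<close> and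
        averaged by \<open>N\<close>; the factor \<open>exp ?q\<close> from earlier steps is
        constant. That \<open>N\<close> lives on \<open>K (Suc i)\<close> enters in the oscillation
        estimate below.\<close>
      also have "\<dots> \<le> N (\<lambda>x\<in>carrier G. exp ?q * ltrans G ?E g x)"
      proof (rule mean_mono[OF supported_mean_carrier[OF Nm] RUCB_ltrans[OF RUCB_Phi[OF IH(1) eR] g]
            RUCB_scale[OF RUCB_ltrans[OF ER g]] subset_refl])
        fix x assume "x \<in> carrier G"
        then show "ltrans G (Phi G (\<mu> i) ?e) g x \<le> (\<lambda>x\<in>carrier G. exp ?q * ltrans G ?E g x) x"
          using IH(3)[of "g \<otimes> x"] g by (simp add: ltrans_def exp_add mult.commute)
      qed
      also have "\<dots> = exp ?q * Phi G N ?E g"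
        using g by (simp add: mean_scale[OF Nm RUCB_ltrans[OF ER g]] Phi_def)
      also have "\<dots> \<le> exp ?q * exp (t * Phi G N F g + t\<^sup>2 * (c i)\<^sup>2 / 2)"
        unfolding c_def
        by (intro mult_left_mono Phi_exp_le[OF N(1) sg FR g]
            oscillation_le[OF d bd sgi sg FL IH(2) g]) auto
      also have "\<dots> = exp (t * Phi G (\<mu> (Suc i)) f g + t\<^sup>2 * (\<Sum>j<Suc i. (c j)\<^sup>2) / 2)"
        by (simp add: \<mu> Phi_conv[OF fR] F_def field_simps flip: exp_add)
      finally show ?thesis .
    qed
    have "\<mu> (Suc i) \<in> means G T" unfolding \<mu> by (rule conv_in_means[OF Nm IH(1)])
    moreover have "Phi G (\<mu> (Suc i)) f = Phi G N F" by (simp only: \<mu> Phi_conv[OF fR] F_def)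
    ultimately show ?case using step Phi_right_invariant[OF N(2) Kc FR] by (metis (no_types, lifting))
  qed
  \<comment> \<open>At the identity, \<open>Phi G (\<mu> n)\<close> gives back
    \<open>\<mu> n\<close>, since translation by \<open>\<one>\<close> fixes extensional
    functions.\<close>
  from this[of n] have *: "\<mu> n \<in> means G T"
      "Phi G (\<mu> n) ?e \<one> \<le> exp (t * Phi G (\<mu> n) f \<one> + t\<^sup>2 * (\<Sum>j<n. (c j)\<^sup>2) / 2)"
    by auto
  have "(chain_length G K n d)\<^sup>2 = (\<Sum>j<n. (c j)\<^sup>2)"
    by (simp add: chain_length_def c_def sum_nonneg)
  moreover have "f \<in> extensional (carrier G)" using fR by (simp add: RUCB_iff)
  ultimately show "\<mu> n (\<lambda>x\<in>carrier G. exp (t * f x)) \<le> exp (t * \<mu> n f + t\<^sup>2 * (chain_length G K n d)\<^sup>2 / 2)"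
    using *(2) by (simp add: Phi_def ltrans_one)
  show "\<mu> n \<in> means G T" by (rule *(1))
qed

section \<open>Tail estimates for the representing measure\<close>

lemma space_is_hat:
  assumes "is_hat G T \<mu> M" shows "space M = samuel G T"
proof -
  have "sets M = sets (sigma (topspace (samuel_topology G T)) {U. openin (samuel_topology G T) U})"
    using assms by (simp add: is_hat_def regular_borel_prob_def)
  then have "space M = space (sigma (topspace (samuel_topology G T)) {U. openin (samuel_topology G T) U})"
    by (rule sets_eq_imp_space_eq)
  also have "\<dots> = topspace (samuel_topology G T)"
    by (rule space_measure_of) (use openin_subset in blast)
  \<comment> \<open>Elements of \<open>samuel G T\<close> are extensional on
    \<open>RUCB G T\<close>, so they all lie in the product space.\<close>
  also have "\<dots> = samuel G T"
    by (auto simp: samuel_topology_def samuel_def PiE_def)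
  finally show ?thesis .
qed

text \<open>The integral of \<open>\<xi> (exp (t f))\<close> is positive, so integrability comes for free: a
  non-integrable function has integral \<open>0\<close>.\<close>

lemma is_hat_tail_le:
  assumes hat: "is_hat G T \<mu> M" and \<mu>: "\<mu> \<in> means G T" and f: "f \<in> RUCB G T"
  shows "{\<xi> \<in> space M. exp a \<le> \<xi> (\<lambda>x\<in>carrier G. exp (t * f x))} \<in> sets M" (is "?A \<in> _")
    and "measure M {\<xi> \<in> space M. exp a \<le> \<xi> (\<lambda>x\<in>carrier G. exp (t * f x))}
      \<le> \<mu> (\<lambda>x\<in>carrier G. exp (t * f x)) * exp (- a)"
proof -
  let ?e = "\<lambda>x\<in>carrier G. exp (t * f x)"
  have eR: "?e \<in> RUCB G T" using f by (rule RUCB_exp)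
  have int: "(\<integral>\<xi>. \<xi> ?e \<partial>M) = \<mu> ?e" using hat eR by (simp add: is_hat_def)
  have "0 < \<mu> ?e" using exp_mean_le[OF \<mu> f, of t] exp_gt_zero less_le_trans by blast
  then have integrable: "integrable M (\<lambda>\<xi>. \<xi> ?e)"
    using int not_integrable_integral_eq by fastforce
  \<comment> \<open>Measurability of the tail set is drawn from integrability instead of from
    continuity of evaluation.\<close>
  then have [measurable]: "(\<lambda>\<xi>. \<xi> ?e) \<in> borel_measurable M" by simp
  show "?A \<in> sets M" by measurable
  have "AE \<xi> in M. 0 \<le> \<xi> ?e"
    using samuel_nonneg[OF _ eR] space_is_hat[OF hat] by (intro AE_I2) simp
  from integral_Markov_inequality_measure[OF integrable sets.empty_sets this, of "exp a"]
  show "measure M ?A \<le> \<mu> ?e * exp (- a)"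
    by (simp add: int exp_minus field_simps)
qed

end

section \<open>Chernoff bound and choice of the exponential parameter\<close>

theorem theorem1p1:
  fixes G :: "('a, 'b) monoid_scheme" and T :: "'a topology"
    and K :: "nat \<Rightarrow> 'a set" and n :: nat
    and \<nu> :: "nat \<Rightarrow> ('a \<Rightarrow> real) \<Rightarrow> real" and \<mu> :: "('a \<Rightarrow> real) \<Rightarrow> real"
    and M :: "(('a \<Rightarrow> real) \<Rightarrow> real) measure"
    and d :: "'a \<Rightarrow> 'a \<Rightarrow> real" and f :: "'a \<Rightarrow> real" and \<epsilon> :: real
  assumes "topological_group G T"
    and "K 0 = {\<one>\<^bsub>G\<^esub>}" and "K n = carrier G"
    and "\<And>i. i \<le> n \<Longrightarrow> subgroup (K i) G"
    and "\<And>i. i < n \<Longrightarrow> K i \<subseteq> K (Suc i)"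
    and "\<And>i. i \<le> n \<Longrightarrow> amenable (G\<lparr>carrier := K i\<rparr>) (subtopology T (K i))"
    and "\<And>i. i \<in> {1..n} \<Longrightarrow>
           left_invariant_mean (G\<lparr>carrier := K i\<rparr>) (subtopology T (K i)) (K i) (\<nu> i)"
    and "\<mu> = conv_prod G T (\<lambda>i. mean_embed G T (K i) (\<nu> i)) n"
    and "is_hat G T \<mu> M"
    and "pseudo_metric_on (carrier G) d" and "bounded_pseudo_metric (carrier G) d"
    and "continuous_pseudo_metric T d" and "right_invariant G d"
    and "f \<in> Lip1 G d" and "\<epsilon> > 0"
  shows "measure M {\<xi> \<in> samuel G T. \<bar>\<xi> f - \<mu> f\<bar> \<ge> \<epsilon>} \<le>
           (if chain_length G K n d = 0 then 0
            else 2 * exp (- (\<epsilon>\<^sup>2 / (2 * (chain_length G K n d)\<^sup>2))))"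
proof -
  interpret topological_group G T by fact
  define l where "l = chain_length G K n d"
  have fR: "f \<in> RUCB G T" using Lip1_subset_RUCB[OF assms(10-13)] assms(14) by blast
  have mean: "\<mu> \<in> means G T"
    unfolding assms(8) by (rule conv_prod_exp_le(1)[where K = K, OF assms(2) _ _ assms(10-14)]) (use assms(4,7) in auto)
  have bound: "\<mu> (\<lambda>x\<in>carrier G. exp (t * f x)) \<le> exp (t * \<mu> f + t\<^sup>2 * l\<^sup>2 / 2)" for t
    unfolding assms(8) l_def
    by (rule conv_prod_exp_le(2)[where K = K, OF assms(2) _ _ assms(10-14)]) (use assms(4,7) in auto)
  note tail = is_hat_tail_le[OF assms(9) mean fR]
  interpret M: prob_space M using assms(9) by (simp add: is_hat_def regular_borel_prob_def)
  have chernoff: "measure M {\<xi> \<in> samuel G T. \<bar>\<xi> f - \<mu> f\<bar> \<ge> \<epsilon>} \<le> 2 * exp (t\<^sup>2 * l\<^sup>2 / 2 - t * \<epsilon>)"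
    if t: "t > 0" for t
  proof -
    \<comment> \<open>The sign of \<open>s\<close> selects the side: \<open>A t\<close> covers
      upward deviations and \<open>A (- t)\<close> downward ones, with the same margin
      \<open>t * \<epsilon>\<close>. Membership is phrased through the image of the exponential,
      whose mean is controlled by \<open>bound\<close>.\<close>
    define A where "A s = {\<xi> \<in> space M. exp (s * \<mu> f + t * \<epsilon>) \<le> \<xi> (\<lambda>x\<in>carrier G. exp (s * f x))}" for s
    have A: "A s \<in> sets M" for s unfolding A_def by (rule tail(1))
    have le: "measure M (A s) \<le> exp (s\<^sup>2 * l\<^sup>2 / 2 - t * \<epsilon>)" for s
    proof -
      have "measure M (A s) \<le> exp (s * \<mu> f + s\<^sup>2 * l\<^sup>2 / 2) * exp (- (s * \<mu> f + t * \<epsilon>))"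
        unfolding A_def by (rule order_trans[OF tail(2)]) (intro mult_right_mono bound, simp)
      then show ?thesis by (simp flip: exp_add)
    qed
    have "\<xi> \<in> A t \<union> A (- t)" if \<xi>: "\<xi> \<in> samuel G T" and dev: "\<bar>\<xi> f - \<mu> f\<bar> \<ge> \<epsilon>" for \<xi>
    proof -
      have "t * \<epsilon> \<le> t * \<bar>\<xi> f - \<mu> f\<bar>" using t dev by simp
      then have "t * \<mu> f + t * \<epsilon> \<le> t * \<xi> f \<or> (- t) * \<mu> f + t * \<epsilon> \<le> (- t) * \<xi> f"
        by (auto simp: abs_if algebra_simps split: if_splits)
      moreover have "\<xi> \<in> A s" if "s * \<mu> f + t * \<epsilon> \<le> s * \<xi> f" for s
      proof -
        have "exp (s * \<mu> f + t * \<epsilon>) \<le> exp (s * \<xi> f)" using that by simp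
        also have "\<dots> \<le> \<xi> (\<lambda>x\<in>carrier G. exp (s * f x))"
          using exp_mean_le[OF _ fR] samuel_subset_means \<xi> by blast
        finally show ?thesis unfolding A_def using \<xi> space_is_hat[OF assms(9)] by blast
      qed
      ultimately show ?thesis by blast
    qed
    then have "measure M {\<xi> \<in> samuel G T. \<bar>\<xi> f - \<mu> f\<bar> \<ge> \<epsilon>} \<le> measure M (A t \<union> A (- t))"
      by (intro M.finite_measure_mono) (use A in auto)
    also have "\<dots> \<le> measure M (A t) + measure M (A (- t))"
      by (rule measure_Un_le) (use A in auto)
    also have "\<dots> \<le> 2 * exp (t\<^sup>2 * l\<^sup>2 / 2 - t * \<epsilon>)" using le[of t] le[of "- t"] by simp
    finally show ?thesis .
  qed
  show ?thesis
  proof (cases "l = 0")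
    case True
    have "m \<le> 0" if m: "m = measure M {\<xi> \<in> samuel G T. \<bar>\<xi> f - \<mu> f\<bar> \<ge> \<epsilon>}" for m
    proof (rule ccontr)
      assume "\<not> m \<le> 0"
      then have m0: "m > 0" by simp
      \<comment> \<open>For \<open>l = 0\<close> the bound is
        \<open>2 * exp (- t * \<epsilon>)\<close> for every positive \<open>t\<close>. Instead of a
        limit, a single \<open>t\<close> with \<open>t * \<epsilon> = 2 / m\<close> is used; then
        \<open>m * exp (2 / m)\<close> is at most 2 but at least \<open>m + 2\<close>.\<close>
      have "m \<le> 2 * exp (- (2 / m))"
        using chernoff[of "2 / (m * \<epsilon>)"] m m0 \<open>\<epsilon> > 0\<close> True by simp
      then have "m * exp (2 / m) \<le> 2" by (simp add: exp_minus field_simps)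
      moreover have "m * (1 + 2 / m) \<le> m * exp (2 / m)"
        using m0 by (intro mult_left_mono exp_ge_add_one_self) simp
      moreover have "m * (1 + 2 / m) = m + 2" using m0 by (simp add: field_simps)
      ultimately show False using m0 by linarith
    qed
    from this[OF refl] show ?thesis using True by (simp add: l_def)
  next
    case False
    \<comment> \<open>This value of \<open>t\<close> minimises the quadratic exponent
      \<open>t\<^sup>2 * l\<^sup>2 / 2 - t * \<epsilon>\<close>.\<close>
    have "\<epsilon> / l\<^sup>2 > 0" using False \<open>\<epsilon> > 0\<close> by simp
    from chernoff[OF this]
    have "measure M {\<xi> \<in> samuel G T. \<bar>\<xi> f - \<mu> f\<bar> \<ge> \<epsilon>} \<le> 2 * exp ((\<epsilon> / l\<^sup>2)\<^sup>2 * l\<^sup>2 / 2 - \<epsilon> / l\<^sup>2 * \<epsilon>)" .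
    also have "(\<epsilon> / l\<^sup>2)\<^sup>2 * l\<^sup>2 / 2 - \<epsilon> / l\<^sup>2 * \<epsilon> = - (\<epsilon>\<^sup>2 / (2 * l\<^sup>2))"
      using False by (simp add: field_simps power2_eq_square)
    finally show ?thesis using False by (simp add: l_def)
  qed
qed

end
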